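(* Let $\mathcal{A}:\mathbb{R}^{n\times n}\to\mathbb{R}^m$ be a linear map, let $X\in\mathbb{R}^{n\times n}$ be a matrix of rank $r$ with singular value decomposition $X=U_X\Lambda_XV_X^*$, and let $b=\mathcal{A}(X)$. Consider the nuclear norm minimization problem: minimize $\|Y\|_*$ over $Y\in\mathbb{R}^{n\times n}$ subject to $\mathcal{A}(Y)=b$. Let $\overline{U_X},\overline{V_X}$ be such that $[U_X\ \overline{U_X}]$ and $[V_X\ \overline{V_X}]$ are unitary (real orthogonal) matrices in $\mathbb{R}^{n\times n}$. For any $Q\in\mathbb{R}^{n\times n}$ define $Q'=\begin{bmatrix}A'&B'\\C'&D'\end{bmatrix}\in\mathbb{R}^{n\times n}$, with $A'\in\mathbb{R}^{r\times r}$ and $D'\in\mathbb{R}^{(n-r)\times(n-r)}$, by $$Q=[U_X\ \overline{U_X}]\,Q'\,[V_X\ \overline{V_X}]^*.$$ Let $D'=U_{D'}\Lambda_{D'}V_{D'}^*$ be a singular value decomposition of $D'$, let $[U_{D'}\ \overline{U_{D'}}]$ and $[V_{D'}\ \overline{V_{D'}}]$ be unitary (real orthogonal) matrices in $\mathbb{R}^{(n-r)\times(n-r)}$, and define $Q''=\begin{bmatrix}A''&B''\\C''&D''\end{bmatrix}\in\mathbb{R}^{n\times n}$, with $A''\in\mathbb{R}^{r\times r}$ and $D''\in\mathbb{R}^{(n-r)\times(n-r)}$, by $$Q'=\begin{bmatrix}I_{r\times r}&\mathbf{0}&\mathbf{0}\\\mathbf{0}&U_{D'}&\overline{U_{D'}}\end{bmatrix}\,Q''\,\begin{bmatrix}I_{r\times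 r}&\mathbf{0}&\mathbf{0}\\\mathbf{0}&V_{D'}&\overline{V_{D'}}\end{bmatrix}^*.$$ Then $X$ is the unique solution of the nuclear norm minimization problem if and only if every nonzero $Q\in\mathbb{R}^{n\times n}$ in the null space of $\mathcal{A}$ satisfies one of the following two conditions: (1) $\mathrm{Tr}(U_X^TQV_X)+\|\overline{U_X}^TQ\overline{V_X}\|_*=0$, and moreover $Q''$ satisfies at least one of the following: (a) the row space of $B''$ is not a subspace of the row space of $D''$; (b) the column space of $C''$ is not a subspace of the column space of $D''$; (c) $Q''$ is not a symmetric matrix. (2) $\mathrm{Tr}(U_X^TQV_X)+\|\overline{U_X}^TQ\overline{V_X}\|_*>0$.
   Context: $\|\cdot\|_*$ is the nuclear norm (sum of singular values), $\mathrm{Tr}$ the trace, $^T$ the transpose and $^*$ the conjugate transpose (equal to the transpose for real matrices). Singular value decompositions are compact: for a real matrix $M$ of rank $k$, $M=U_M\Lambda_MV_M^*$ where $U_M$ and $V_M$ are real with $k$ orthonormal columns and $\Lambda_M\in\mathbb{R}^{k\times k}$ is diagonal with the positive singular values of $M$ on its diagonal. In particular, $U_X$ and $V_X$ have $r$ columns. The matrices with overlines complete the corresponding orthonormal columns to an orthonormal basis (and may have no columns). The symbol $\mathbf{0}$ denotes a zero matrix of appropriate size. *)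

theory Defs
  imports
    Complex_Main
    "HOL-Computational_Algebra.Polynomial"
    "HOL-Library.Multiset"
    "Jordan_Normal_Form.Char_Poly"
    "Jordan_Normal_Form.VS_Connect"
    "Jordan_Normal_Form.DL_Rank"
begin

text \<open>
  The singular values of a real matrix, listed with multiplicity: the square roots of the
  eigenvalues of \<open>M\<^sup>T * M\<close>, an eigenvalue being counted as often as it is a root of the
  characteristic polynomial. For a matrix with more columns than rows, this list has additional
  zeros compared to the convention with \<open>min (dim_row M) (dim_col M)\<close> entries; neither the
  nuclear norm nor the positive singular values are affected.
\<close>

definition singular_values :: "real mat \<Rightarrow> real multiset" where
  "singular_values M = image_mset sqrt (proots (char_poly (M\<^sup>T * M)))"

definition nuclear_norm :: "real mat \<Rightarrow> real" where
  "nuclear_norm M = sum_mset (singular_values M)"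

text \<open>
  \<open>M = U * L * V\<^sup>T\<close> is a compact singular value decomposition. The diagonal entries of \<open>L\<close> are
  the positive singular values with multiplicity, in no prescribed order.
\<close>

definition compact_svd :: "real mat \<Rightarrow> real mat \<Rightarrow> real mat \<Rightarrow> real mat \<Rightarrow> bool" where
  "compact_svd M U L V \<longleftrightarrow>
    (let k = vec_space.rank (dim_row M) M in
      U \<in> carrier_mat (dim_row M) k \<and> U\<^sup>T * U = 1\<^sub>m k \<and>
      V \<in> carrier_mat (dim_col M) k \<and> V\<^sup>T * V = 1\<^sub>m k \<and>
      L \<in> carrier_mat k k \<and> diagonal_mat L \<and>
      mset (diag_mat L) = filter_mset (\<lambda>s. s > 0) (singular_values M) \<and>
      M = U * L * V\<^sup>T)"

text \<open>
  Unlike \<^const>\<open>orthogonal_mat\<close>, which only asks for pairwise orthogonal nonzero columns, this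
  is the usual notion of a real orthogonal matrix.
\<close>

definition real_unitary_mat :: "nat \<Rightarrow> real mat \<Rightarrow> bool" where
  "real_unitary_mat n P \<longleftrightarrow>
    P \<in> carrier_mat n n \<and> P\<^sup>T * P = 1\<^sub>m n \<and> P * P\<^sup>T = 1\<^sub>m n"

text \<open>The matrix \<open>[A B]\<close>, for matrices with the same number of rows.\<close>

definition append_cols :: "real mat \<Rightarrow> real mat \<Rightarrow> real mat" (infixr \<open>@\<^sub>c\<close> 65) where
  "A @\<^sub>c B = four_block_mat A B (0\<^sub>m 0 (dim_col A)) (0\<^sub>m 0 (dim_col B))"

definition trace_mat :: "real mat \<Rightarrow> real" where
  "trace_mat A = sum_list (diag_mat A)"

definition symmetric_mat :: "real mat \<Rightarrow> bool" where
  "symmetric_mat A \<longleftrightarrow> A\<^sup>T = A"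

definition nuclear_norm_solution ::
    "nat \<Rightarrow> (real mat \<Rightarrow> real vec) \<Rightarrow> real vec \<Rightarrow> real mat \<Rightarrow> bool" where
  "nuclear_norm_solution n \<A> b Y \<longleftrightarrow>
    is_arg_min nuclear_norm (\<lambda>Z. Z \<in> carrier_mat n n \<and> \<A> Z = b) Y"

end

theory Submission
  imports Defs "Jordan_Normal_Form.Schur_Decomposition"
begin

text \<open>
  The orthogonal changes of coordinates do not affect the nuclear norm, and they turn \<open>X\<close> into
  \<open>diag(x)\<close>, with \<open>x\<^sub>i > 0\<close> for \<open>i < r\<close> and \<open>x\<^sub>i = 0\<close> otherwise, and a direction \<open>Q\<close> into \<open>Q''\<close>. The lower
  right block of \<open>Q''\<close> is diagonal and nonnegative, so its nuclear norm is its trace and the number in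
  the two conditions is simply \<open>tr Q''\<close> (\<open>rotated_coordinates\<close>, \<open>diagonal_model\<close>).

  The main tool is the trace inequality: \<open>tr M \<le> \<parallel>M\<parallel>\<^sub>*\<close> for every square matrix \<open>M\<close>, with equality
  exactly when \<open>M\<close> is symmetric positive semidefinite (\<open>trace_mat_le_nuclear_norm\<close>,
  \<open>trace_mat_eq_nuclear_norm_imp_psd\<close>, \<open>nuclear_norm_psd\<close>). Since \<open>\<parallel>X\<parallel>\<^sub>* = tr diag(x)\<close>, there are three
  cases for a direction \<open>Q\<close> in the null space.

  If \<open>tr Q'' > 0\<close>, then \<open>\<parallel>X + Q\<parallel>\<^sub>* \<ge> tr (diag(x) + Q'') > \<parallel>X\<parallel>\<^sub>*\<close>.

  If \<open>tr Q'' = 0\<close>, the same chain gives \<open>\<parallel>X + t Q\<parallel>\<^sub>* \<ge> \<parallel>X\<parallel>\<^sub>*\<close>, with equality exactly when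
  \<open>diag(x) + t Q''\<close> is positive semidefinite. For some \<open>t > 0\<close> this holds
  if and only if \<open>Q''\<close> is symmetric and its off-diagonal blocks \<open>B''\<close> and \<open>C''\<close> are supported where
  the diagonal of \<open>D''\<close> is positive, which is the failure of (a), (b) and (c)
  (\<open>nuclear_norm_not_increased_imp_psd\<close>, \<open>nuclear_norm_eq_trace_near_diagonal\<close>).

  If \<open>tr Q'' < 0\<close>, the nuclear norm decreases along \<open>Q\<close> (\<open>nuclear_norm_descent\<close>). The argument uses
  an orthogonal matrix \<open>W\<close> with \<open>tr (W M) = \<parallel>M\<parallel>\<^sub>*\<close> for \<open>M = diag(x) + t Q''\<close> and shows that \<open>W\<close> is close
  to the identity on the first \<open>r\<close> coordinates.

  The facts about the trace rest on the existence of a singular value decomposition for every real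
  square matrix (\<open>real_singular_value_decomposition\<close>).
\<close>

section \<open>Orthogonal matrices and the singular value decomposition\<close>

text \<open>
  The carrier conditions of associativity contain inner dimensions that the rewritten term does
  not show; fixing all of them to \<open>n\<close> lets the simplifier discharge these conditions.
\<close>

lemmas square_mat_assoc = assoc_mult_mat[of _ n n _ n _ n] mult_carrier_mat[of _ n n _ n] for n

lemma real_unitary_mat_transpose:
  "real_unitary_mat n P \<Longrightarrow> real_unitary_mat n P\<^sup>T"
  by (auto simp: real_unitary_mat_def)

lemma real_unitary_mat_mult:
  assumes "real_unitary_mat n P" "real_unitary_mat n R"
  shows "real_unitary_mat n (P * R)"
proof -
  have c: "P \<in> carrier_mat n n" "R \<in> carrier_mat n n"
    and o: "P\<^sup>T * P = 1\<^sub>m n" "P * P\<^sup>T = 1\<^sub>m n" "R\<^sup>T * R = 1\<^sub>m n" "R * R\<^sup>T = 1\<^sub>m n"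
    using assms by (auto simp: real_unitary_mat_def)
  have t: "(P * R)\<^sup>T = R\<^sup>T * P\<^sup>T" using c by (rule transpose_mult[of _ n n _ n])
  have "R\<^sup>T * P\<^sup>T * (P * R) = R\<^sup>T * (P\<^sup>T * P) * R"
    using c by (simp add: square_mat_assoc[where n = n])
  moreover have "P * R * (R\<^sup>T * P\<^sup>T) = P * (R * R\<^sup>T) * P\<^sup>T"
    using c by (simp add: square_mat_assoc[where n = n])
  moreover have "R\<^sup>T * 1\<^sub>m n = R\<^sup>T" "P * 1\<^sub>m n = P" using c by auto
  ultimately show ?thesis using c by (simp add: real_unitary_mat_def t o)
qed

lemma mult_block_diagonal:
  fixes A1 :: "'a :: comm_ring_1 mat"
  assumes "A1 \<in> carrier_mat a b" "D1 \<in> carrier_mat c d" "A2 \<in> carrier_mat b e" "D2 \<in> carrier_mat d f"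
  shows "four_block_mat A1 (0\<^sub>m a d) (0\<^sub>m c b) D1 * four_block_mat A2 (0\<^sub>m b f) (0\<^sub>m d e) D2
    = four_block_mat (A1 * A2) (0\<^sub>m a f) (0\<^sub>m c e) (D1 * D2)"
proof -
  have "A1 * A2 \<in> carrier_mat a e" "D1 * D2 \<in> carrier_mat c f" using assms by auto
  then show ?thesis
    using mult_four_block_mat[OF assms(1) zero_carrier_mat zero_carrier_mat assms(2)
        assms(3) zero_carrier_mat zero_carrier_mat assms(4)] assms
    by simp
qed

lemma transpose_block_diagonal:
  assumes "A \<in> carrier_mat a b" "D \<in> carrier_mat c d"
  shows "(four_block_mat A (0\<^sub>m a d) (0\<^sub>m c b) D)\<^sup>T = four_block_mat A\<^sup>T (0\<^sub>m b c) (0\<^sub>m d a) D\<^sup>T"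
  using transpose_four_block_mat[OF assms(1) zero_carrier_mat zero_carrier_mat assms(2)] by simp

lemma real_unitary_mat_one_block:
  assumes "real_unitary_mat n U"
  shows "real_unitary_mat (k + n) (four_block_mat (1\<^sub>m k) (0\<^sub>m k n) (0\<^sub>m n k) U)"
  using assms
  by (auto simp: real_unitary_mat_def transpose_block_diagonal[of _ k k _ n n]
      mult_block_diagonal[of _ k k _ n n _ k _ n])

text \<open>
  Over \<open>\<complex>\<close> the characteristic polynomial has a root \<open>l\<close>, with an eigenvector \<open>v\<close>. Symmetry
  makes the number \<open>h = v\<^sup>* S v = l \<bar>v\<bar>\<^sup>2\<close> equal to its own conjugate, so \<open>l\<close> is real and therefore
  a root of the real characteristic polynomial.
\<close>

lemma real_symmetric_mat_has_eigenvector: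
  fixes S :: "real mat"
  assumes S: "S \<in> carrier_mat n n" and sym: "S\<^sup>T = S" and n: "n \<noteq> 0"
  obtains v e where "v \<in> carrier_vec n" "v \<noteq> 0\<^sub>v n" "S *\<^sub>v v = e \<cdot>\<^sub>v v"
proof -
  interpret of_real_hom: inj_comm_ring_hom "of_real :: real \<Rightarrow> complex"
    by unfold_locales auto
  define C where "C = map_mat complex_of_real S"
  have C: "C \<in> carrier_mat n n" using S by (simp add: C_def)
  obtain as where as: "char_poly C = (\<Prod>a\<leftarrow>as. [:- a, 1:])" "length as = n"
    using char_poly_factorized[OF C] by blast
  then obtain l as' where "as = l # as'" using n by (cases as) auto
  then have root: "poly (char_poly C) l = 0" using as by simp
  then have "eigenvalue C l" using eigenvalue_root_char_poly[OF C] by simp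
  then obtain v where v: "v \<in> carrier_vec n" "v \<noteq> 0\<^sub>v n" "C *\<^sub>v v = l \<cdot>\<^sub>v v"
    using C unfolding eigenvalue_def eigenvector_def by auto
  have S_sym: "S $$ (i, j) = S $$ (j, i)" if "i < n" "j < n" for i j
    using arg_cong[OF sym, of "\<lambda>A. A $$ (i, j)"] S that by simp
  have Cv: "(\<Sum>j<n. of_real (S $$ (i, j)) * v $ j) = l * v $ i" if "i < n" for i
  proof -
    have "(C *\<^sub>v v) $ i = (\<Sum>j<n. of_real (S $$ (i, j)) * v $ j)"
      using that v(1) S by (auto simp: C_def scalar_prod_def lessThan_atLeast0 intro!: sum.cong)
    then show ?thesis using v that by simp
  qed
  define h where "h = (\<Sum>i<n. \<Sum>j<n. cnj (v $ i) * of_real (S $$ (i, j)) * v $ j)"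
  define s where "s = (\<Sum>i<n. (cmod (v $ i))\<^sup>2)"
  have "h = (\<Sum>i<n. cnj (v $ i) * (l * v $ i))"
    unfolding h_def by (auto simp: Cv[symmetric] sum_distrib_left mult.assoc intro!: sum.cong)
  also have "\<dots> = l * of_real s"
    unfolding s_def of_real_sum sum_distrib_left
    by (rule sum.cong) (auto simp: complex_norm_square mult_ac simp del: of_real_power)
  finally have h: "h = l * of_real s" .
  have "cnj h = (\<Sum>i<n. \<Sum>j<n. v $ i * of_real (S $$ (i, j)) * cnj (v $ j))"
    unfolding h_def by simp
  also have "\<dots> = (\<Sum>j<n. \<Sum>i<n. v $ i * of_real (S $$ (i, j)) * cnj (v $ j))"
    by (rule sum.swap)
  also have "\<dots> = h" unfolding h_def
    by (intro sum.cong refl) (simp add: S_sym)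
  finally have "cnj l * of_real s = l * of_real s" using h by simp
  moreover have "s \<noteq> 0"
  proof
    assume "s = 0"
    then have "\<forall>i\<in>{..<n}. (cmod (v $ i))\<^sup>2 = 0"
      unfolding s_def by (subst (asm) sum_nonneg_eq_0_iff) auto
    then have "v = 0\<^sub>v n" using v(1) by (intro eq_vecI) auto
    then show False using v(2) by simp
  qed
  ultimately have "cnj l = l" by simp
  then have l: "l = of_real (Re l)" by (simp add: complex_eq_iff)
  have "char_poly C = map_poly of_real (char_poly S)"
    unfolding C_def by (rule of_real_hom.char_poly_hom[OF S])
  then have "poly (map_poly complex_of_real (char_poly S)) (of_real (Re l)) = 0"
    using root l by simp
  then have "poly (char_poly S) (Re l) = 0" by simp
  then have "eigenvalue S (Re l)" using eigenvalue_root_char_poly[OF S] by simp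
  then show ?thesis using that S unfolding eigenvalue_def eigenvector_def by auto
qed

text \<open>
  Complete \<open>v\<close> to a basis, apply Gram-Schmidt to it (which keeps its first vector) and normalize
  the columns.
\<close>

lemma real_unitary_mat_with_first_column:
  fixes v :: "real vec"
  assumes v: "v \<in> carrier_vec n" and v0: "v \<noteq> 0\<^sub>v n"
  obtains W c where "real_unitary_mat n W" "c > 0" "col W 0 = c \<cdot>\<^sub>v v"
proof -
  interpret cof_vec_space n "TYPE(real)" .
  define b where "b = basis_completion v"
  define ws where "ws = gram_schmidt n b"
  from basis_completion[OF v v0, folded b_def]
  have dist_b: "distinct b" and indep: "\<not> lin_dep (set b)" and b: "set b \<subseteq> carrier_vec n"
    and hdb: "hd b = v" and len_b: "length b = n" by auto
  have n: "0 < n" using v v0 by (cases n) auto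
  obtain vs where bv: "b = v # vs" using hdb len_b n by (cases b) auto
  from gram_schmidt_result[OF b dist_b indep refl, folded ws_def]
  have ws: "set ws \<subseteq> carrier_vec n" "corthogonal ws" "length ws = n"
    by (auto simp: len_b)
  have "hd ws = v" using gram_schmidt_hd[OF v, of vs] bv by (simp add: ws_def)
  then have ws0: "ws ! 0 = v" using ws(3) n by (cases ws) auto
  have orth: "(ws ! i \<bullet> ws ! j = 0) = (i \<noteq> j)" if "i < n" "j < n" for i j
    using corthogonalD[OF ws(2), of i j] that ws(3) by simp
  have pos: "ws ! i \<bullet> ws ! i > 0" if "i < n" for i
  proof -
    have "ws ! i \<bullet> ws ! i \<ge> 0" by (simp add: scalar_prod_def sum_nonneg)
    then show ?thesis using orth[OF that that] by linarith
  qed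
  define c where "c i = 1 / sqrt (ws ! i \<bullet> ws ! i)" for i
  define W where "W = mat_of_cols n (map (\<lambda>i. c i \<cdot>\<^sub>v ws ! i) [0..<n])"
  have wsc: "ws ! i \<in> carrier_vec n" if "i < n" for i using ws that by auto
  have W: "W \<in> carrier_mat n n" by (simp add: W_def mat_of_cols_def)
  have col: "col W i = c i \<cdot>\<^sub>v ws ! i" if "i < n" for i
    unfolding W_def using that wsc[OF that] by (subst col_mat_of_cols) auto
  have "W\<^sup>T * W = 1\<^sub>m n"
  proof (rule eq_matI)
    fix i j assume "i < dim_row (1\<^sub>m n :: real mat)" "j < dim_col (1\<^sub>m n :: real mat)"
    then have ij: "i < n" "j < n" by auto
    have "(W\<^sup>T * W) $$ (i, j) = col W i \<bullet> col W j" using W ij by simp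
    also have "\<dots> = c i * c j * (ws ! i \<bullet> ws ! j)"
      using wsc[OF ij(1)] wsc[OF ij(2)] ij
      by (simp add: col smult_scalar_prod_distrib[of _ n] scalar_prod_smult_distrib[of _ n])
    also have "\<dots> = (1\<^sub>m n :: real mat) $$ (i, j)"
    proof (cases "i = j")
      case True
      have "sqrt (ws ! j \<bullet> ws ! j) * sqrt (ws ! j \<bullet> ws ! j) = ws ! j \<bullet> ws ! j"
        using pos[OF ij(2)] by simp
      then show ?thesis using True ij pos[OF ij(2)] by (simp add: c_def field_simps)
    next
      case False
      then show ?thesis using orth[OF ij] ij by simp
    qed
    finally show "(W\<^sup>T * W) $$ (i, j) = (1\<^sub>m n :: real mat) $$ (i, j)" .
  qed (use W in auto)
  moreover from this have "W * W\<^sup>T = 1\<^sub>m n"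
    by (rule mat_mult_left_right_inverse[rotated 2]) (use W in auto)
  ultimately have "real_unitary_mat n W" using W by (simp add: real_unitary_mat_def)
  moreover have "c 0 > 0" using pos[OF n] by (simp add: c_def)
  ultimately show ?thesis using that col[OF n] ws0 by metis
qed

text \<open>
  This is the step of the singular value decomposition that splits off one singular value. Take
  an eigenvector \<open>v\<close> of \<open>M\<^sup>T M\<close>. If \<open>M v \<noteq> 0\<close>, the directions of \<open>v\<close> and \<open>M v\<close> are a pair of right
  and left singular vectors. Otherwise \<open>M\<close> is singular, so \<open>M\<^sup>T\<close> also kills some nonzero vector \<open>u\<close>,
  and \<open>v\<close> and \<open>u\<close> form a pair for the singular value 0.
\<close>

lemma paired_singular_vectors:
  fixes M :: "real mat"
  assumes M: "M \<in> carrier_mat n n" and n: "n \<noteq> 0"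
  obtains U V s s' where "real_unitary_mat n U" "real_unitary_mat n V" "s \<ge> 0"
    "M *\<^sub>v col V 0 = s \<cdot>\<^sub>v col U 0" "M\<^sup>T *\<^sub>v col U 0 = s' \<cdot>\<^sub>v col V 0"
proof -
  have S: "M\<^sup>T * M \<in> carrier_mat n n" "(M\<^sup>T * M)\<^sup>T = M\<^sup>T * M"
    using M by (auto simp: transpose_mult[of _ n n _ n])
  obtain v e where v: "v \<in> carrier_vec n" "v \<noteq> 0\<^sub>v n" "M\<^sup>T * M *\<^sub>v v = e \<cdot>\<^sub>v v"
    using real_symmetric_mat_has_eigenvector[OF S n] by metis
  obtain V c where V: "real_unitary_mat n V" "c > 0" "col V 0 = c \<cdot>\<^sub>v v"
    using real_unitary_mat_with_first_column[OF v(1,2)] by metis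
  have Mv: "M *\<^sub>v v \<in> carrier_vec n" using M v by simp
  have MTMv: "M\<^sup>T *\<^sub>v (M *\<^sub>v v) = e \<cdot>\<^sub>v v"
    using v(3) M v(1) by (metis assoc_mult_mat_vec transpose_carrier_mat)
  show ?thesis
  proof (cases "M *\<^sub>v v = 0\<^sub>v n")
    case False
    obtain U d where U: "real_unitary_mat n U" "d > 0" "col U 0 = d \<cdot>\<^sub>v (M *\<^sub>v v)"
      using real_unitary_mat_with_first_column[OF Mv False] by metis
    show ?thesis
    proof (rule that[OF U(1) V(1), of "c / d" "d * e / c"])
      show "M *\<^sub>v col V 0 = (c / d) \<cdot>\<^sub>v col U 0"
        using U V M v by (auto simp: mult_mat_vec smult_smult_assoc)
      show "M\<^sup>T *\<^sub>v col U 0 = (d * e / c) \<cdot>\<^sub>v col V 0"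
        using U V M v Mv MTMv by (auto simp: mult_mat_vec smult_smult_assoc)
    qed (use U V in auto)
  next
    case True
    have "det M = 0" using det_0_iff_vec_prod_zero[OF M] v True by blast
    then have "det M\<^sup>T = 0" using det_transpose[OF M] by simp
    moreover have "M\<^sup>T \<in> carrier_mat n n" using M by simp
    ultimately obtain u where u: "u \<in> carrier_vec n" "u \<noteq> 0\<^sub>v n" "M\<^sup>T *\<^sub>v u = 0\<^sub>v n"
      using det_0_iff_vec_prod_zero by blast
    obtain U d where U: "real_unitary_mat n U" "d > 0" "col U 0 = d \<cdot>\<^sub>v u"
      using real_unitary_mat_with_first_column[OF u(1,2)] by metis
    show ?thesis
    proof (rule that[OF U(1) V(1), of 0 0])
      show "M *\<^sub>v col V 0 = 0 \<cdot>\<^sub>v col U 0"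
        using U V M v u True by (auto simp: mult_mat_vec)
      show "M\<^sup>T *\<^sub>v col U 0 = 0 \<cdot>\<^sub>v col V 0"
        using U V M v u by (auto simp: mult_mat_vec[of _ n n])
    qed simp
  qed
qed

lemma real_unitary_mat_col_products:
  assumes "real_unitary_mat n U" "i < n" "j < n"
  shows "col U i \<bullet> col U j = (if i = j then 1 else 0)"
proof -
  have U: "U \<in> carrier_mat n n" "U\<^sup>T * U = 1\<^sub>m n" using assms by (auto simp: real_unitary_mat_def)
  have "col U i \<bullet> col U j = (U\<^sup>T * U) $$ (i, j)" using U(1) assms by simp
  then show ?thesis using U assms by simp
qed

text \<open>
  Induction on the dimension: in orthonormal bases that start with a pair of singular vectors,
  the first row and the first column of \<open>M\<close> vanish outside the corner, and the remaining block is
  decomposed by the induction hypothesis.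
\<close>

theorem real_singular_value_decomposition:
  fixes M :: "real mat"
  assumes "M \<in> carrier_mat n n"
  obtains U V d where "real_unitary_mat n U" "real_unitary_mat n V" "\<And>i. d i \<ge> 0"
    "M = U * mat_diag n d * V\<^sup>T"
  using assms
proof (induction n arbitrary: M thesis)
  case 0
  then show ?case by (intro 0(1)[of "1\<^sub>m 0" "1\<^sub>m 0" "\<lambda>_. 0"]) (auto simp: real_unitary_mat_def)
next
  case (Suc n M)
  let ?n = "Suc n"
  note M = Suc.prems(2)
  obtain U V s s' where U: "real_unitary_mat ?n U" and V: "real_unitary_mat ?n V" and s: "s \<ge> 0"
    and MV: "M *\<^sub>v col V 0 = s \<cdot>\<^sub>v col U 0" and MU: "M\<^sup>T *\<^sub>v col U 0 = s' \<cdot>\<^sub>v col V 0"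
    using paired_singular_vectors[OF M nat.distinct(2)] by metis
  have Uc: "U \<in> carrier_mat ?n ?n" "U * U\<^sup>T = 1\<^sub>m ?n"
    and Vc: "V \<in> carrier_mat ?n ?n" "V * V\<^sup>T = 1\<^sub>m ?n"
    using U V by (auto simp: real_unitary_mat_def)
  define N where "N = U\<^sup>T * M * V"
  have N: "N \<in> carrier_mat ?n ?n" using Uc Vc M by (simp add: N_def)
  have N1: "N = U\<^sup>T * (M * V)" using Uc Vc M by (simp add: N_def)
  have Nij: "N $$ (i, j) = col U i \<bullet> (M *\<^sub>v col V j)" if "i < ?n" "j < ?n" for i j
    unfolding N1 using that Uc Vc M by (simp add: col_mult2[of _ ?n ?n] mult_mat_vec_def)
  have col0: "N $$ (i, 0) = (if i = 0 then s else 0)" if "i < ?n" for i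
    using Nij[OF that, of 0] MV real_unitary_mat_col_products[OF U that, of 0] Uc by simp
  have row0: "N $$ (0, j) = (if j = 0 then s' else 0)" if "j < ?n" for j
  proof -
    have "N $$ (0, j) = col U 0 \<bullet> (M *\<^sub>v col V j)" using Nij that by simp
    also have "\<dots> = (M\<^sup>T *\<^sub>v col U 0) \<bullet> col V j"
      using transpose_vec_mult_scalar[of "M" ?n ?n "col V j" "col U 0"] M Vc that
        col_dim[of U 0] carrier_matD(1)[OF Uc(1)] by simp
    also have "\<dots> = (if j = 0 then s' else 0)"
      using MU real_unitary_mat_col_products[OF V _ that, of 0] Vc by simp
    finally show ?thesis .
  qed
  define N3 where "N3 = mat n n (\<lambda>(i, j). N $$ (Suc i, Suc j))"
  have N3: "N3 \<in> carrier_mat n n" by (simp add: N3_def)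
  obtain U3 V3 d where U3: "real_unitary_mat n U3" and V3: "real_unitary_mat n V3"
    and d: "\<And>i. d i \<ge> 0" and N3_eq: "N3 = U3 * mat_diag n d * V3\<^sup>T"
    using Suc.IH[OF _ N3] by metis
  have U3c: "U3 \<in> carrier_mat n n" and V3c: "V3 \<in> carrier_mat n n"
    using U3 V3 by (auto simp: real_unitary_mat_def)
  define BU where "BU = four_block_mat (1\<^sub>m 1) (0\<^sub>m 1 n) (0\<^sub>m n 1) U3"
  define BV where "BV = four_block_mat (1\<^sub>m 1) (0\<^sub>m 1 n) (0\<^sub>m n 1) V3"
  have BU: "real_unitary_mat ?n BU" and BV: "real_unitary_mat ?n BV"
    unfolding BU_def BV_def
    using real_unitary_mat_one_block[OF U3, of 1] real_unitary_mat_one_block[OF V3, of 1] by auto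
  define e where "e i = (case i of 0 \<Rightarrow> s | Suc k \<Rightarrow> d k)" for i
  have D: "mat_diag ?n e = four_block_mat (mat 1 1 (\<lambda>_. s)) (0\<^sub>m 1 n) (0\<^sub>m n 1) (mat_diag n d)"
    by (rule eq_matI) (auto simp: mat_diag_def e_def split: nat.splits)
  have "N = four_block_mat (mat 1 1 (\<lambda>_. s)) (0\<^sub>m 1 n) (0\<^sub>m n 1) N3"
  proof (rule eq_matI)
    fix i j
    assume "i < dim_row (four_block_mat (mat 1 1 (\<lambda>_. s)) (0\<^sub>m 1 n) (0\<^sub>m n 1) N3)"
      "j < dim_col (four_block_mat (mat 1 1 (\<lambda>_. s)) (0\<^sub>m 1 n) (0\<^sub>m n 1) N3)"
    then have "i < ?n" "j < ?n" using N3 by auto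
    then show "N $$ (i, j) = four_block_mat (mat 1 1 (\<lambda>_. s)) (0\<^sub>m 1 n) (0\<^sub>m n 1) N3 $$ (i, j)"
      using row0[of j] col0[of i] by (auto simp: N3_def)
  qed (use N N3 in auto)
  also have "\<dots> = BU * mat_diag ?n e * BV\<^sup>T"
    unfolding D BU_def BV_def N3_eq
    using U3c V3c by (simp add: transpose_block_diagonal[of _ 1 1 _ n n] mult_block_diagonal[of _ 1 1 _ n n _ 1 _ n]
        del: One_nat_def)
  finally have N_eq: "N = BU * mat_diag ?n e * BV\<^sup>T" .
  have c: "BU \<in> carrier_mat ?n ?n" "BV \<in> carrier_mat ?n ?n"
    using BU BV by (auto simp: real_unitary_mat_def)
  have "M = (U * U\<^sup>T) * M * (V * V\<^sup>T)" using M Uc Vc by simp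
  also have "\<dots> = U * N * V\<^sup>T"
    unfolding N_def using M Uc(1) Vc(1) by (simp add: square_mat_assoc[where n = ?n])
  also have "\<dots> = (U * BU) * mat_diag ?n e * (V * BV)\<^sup>T"
    unfolding N_eq transpose_mult[OF Vc(1) c(2)] using c Uc(1) Vc(1)
    by (simp add: square_mat_assoc[where n = ?n])
  finally have "M = (U * BU) * mat_diag ?n e * (V * BV)\<^sup>T" .
  moreover have "e i \<ge> 0" for i using s d by (simp add: e_def split: nat.splits)
  ultimately show ?case
    using Suc.prems(1) real_unitary_mat_mult[OF U BU] real_unitary_mat_mult[OF V BV] by blast
qed

section \<open>Nuclear norm, trace and positive semidefiniteness\<close>

lemma trace_mat_eq_sum:
  "A \<in> carrier_mat n n \<Longrightarrow> trace_mat A = (\<Sum>i<n. A $$ (i, i))"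
  by (auto simp: trace_mat_def diag_mat_def lessThan_atLeast0 interv_sum_list_conv_sum_set_nat)

lemma trace_mat_mult_eq_sum:
  "A \<in> carrier_mat n m \<Longrightarrow> B \<in> carrier_mat m n \<Longrightarrow>
    trace_mat (A * B) = (\<Sum>i<n. \<Sum>j<m. A $$ (i, j) * B $$ (j, i))"
  by (auto simp: trace_mat_eq_sum[of _ n] scalar_prod_def lessThan_atLeast0 intro!: sum.cong)

lemma trace_mat_comm:
  assumes "A \<in> carrier_mat n m" "B \<in> carrier_mat m n"
  shows "trace_mat (A * B) = trace_mat (B * A)"
  unfolding trace_mat_mult_eq_sum[OF assms] trace_mat_mult_eq_sum[OF assms(2,1)]
  by (subst sum.swap) (simp add: mult.commute)

lemma trace_mat_add:
  "A \<in> carrier_mat n n \<Longrightarrow> B \<in> carrier_mat n n \<Longrightarrow> trace_mat (A + B) = trace_mat A + trace_mat B"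
  by (simp add: trace_mat_eq_sum[of _ n] sum.distrib)

lemma trace_mat_minus:
  "A \<in> carrier_mat n n \<Longrightarrow> B \<in> carrier_mat n n \<Longrightarrow> trace_mat (A - B) = trace_mat A - trace_mat B"
  by (simp add: trace_mat_eq_sum[of _ n] sum_subtractf minus_carrier_mat)

lemma trace_mat_transpose:
  "A \<in> carrier_mat n n \<Longrightarrow> trace_mat A\<^sup>T = trace_mat A"
  by (simp add: trace_mat_eq_sum[of _ n])

lemma trace_mat_smult:
  "A \<in> carrier_mat n n \<Longrightarrow> trace_mat (c \<cdot>\<^sub>m A) = c * trace_mat A"
  by (simp add: trace_mat_eq_sum[of _ n] sum_distrib_left)

text \<open>
  \<open>(U M V\<^sup>T)\<^sup>T (U M V\<^sup>T)\<close> is similar to \<open>M\<^sup>T M\<close>, so the two matrices have the same characteristic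
  polynomial.
\<close>

lemma nuclear_norm_unitary_invariant:
  assumes U: "real_unitary_mat n U" and V: "real_unitary_mat n V" and M: "M \<in> carrier_mat n n"
  shows "nuclear_norm (U * M * V\<^sup>T) = nuclear_norm M"
proof -
  have Uc: "U \<in> carrier_mat n n" "U\<^sup>T * U = 1\<^sub>m n"
    and Vc: "V \<in> carrier_mat n n" "V\<^sup>T * V = 1\<^sub>m n" "V * V\<^sup>T = 1\<^sub>m n"
    using U V by (auto simp: real_unitary_mat_def)
  have "(U * M * V\<^sup>T)\<^sup>T = V * M\<^sup>T * U\<^sup>T"
    using Uc Vc M by (simp add: transpose_mult[of _ n n _ n] square_mat_assoc[where n = n])
  then have "(U * M * V\<^sup>T)\<^sup>T * (U * M * V\<^sup>T) = V * (M\<^sup>T * (U\<^sup>T * U) * M) * V\<^sup>T"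
    using Uc(1) Vc(1) M by (simp add: square_mat_assoc[where n = n])
  also have "\<dots> = V * (M\<^sup>T * M) * V\<^sup>T"
    using Uc M by simp
  finally have "similar_mat ((U * M * V\<^sup>T)\<^sup>T * (U * M * V\<^sup>T)) (M\<^sup>T * M)"
    unfolding similar_mat_def
    by (intro exI[of _ V] exI[of _ "V\<^sup>T"] similar_mat_witI[of _ _ n]) (use Uc Vc M in auto)
  then show ?thesis
    by (simp add: nuclear_norm_def singular_values_def char_poly_similar)
qed

lemma nuclear_norm_mat_diag:
  assumes d: "\<And>i. i < n \<Longrightarrow> d i \<ge> 0"
  shows "nuclear_norm (mat_diag n d) = (\<Sum>i<n. d i)"
proof -
  have t: "(mat_diag n d)\<^sup>T = mat_diag n d" by (rule eq_matI) (auto simp: mat_diag_def)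
  have "char_poly (mat_diag n (\<lambda>i. d i * d i))
      = (\<Prod>a\<leftarrow>diag_mat (mat_diag n (\<lambda>i. d i * d i)). [:- a, 1:])"
    by (rule char_poly_upper_triangular[of _ n]) (auto simp: mat_diag_def)
  also have "diag_mat (mat_diag n (\<lambda>i. d i * d i)) = map (\<lambda>i. d i * d i) [0..<n]"
    by (auto simp: diag_mat_def mat_diag_def)
  finally have "char_poly ((mat_diag n d)\<^sup>T * mat_diag n d)
      = prod_list (map (\<lambda>a. [:- a, 1:]) (map (\<lambda>i. d i * d i) [0..<n]))"
    by (simp add: t)
  moreover have "proots (prod_list (map (\<lambda>a. [:- a, 1:]) xs)) = mset xs" for xs :: "real list"
  proof (induction xs)
    case (Cons a xs)
    have "prod_list (map (\<lambda>a. [:- a, 1:]) xs) \<noteq> 0" by (auto simp: prod_list_zero_iff)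
    then have "proots ([:- a, 1:] * prod_list (map (\<lambda>a. [:- a, 1:]) xs)) = add_mset a (mset xs)"
      by (subst proots_mult) (use Cons in auto)
    then show ?case by (simp only: list.map prod_list.Cons mset.simps)
  qed simp
  ultimately have "singular_values (mat_diag n d) = image_mset sqrt (mset (map (\<lambda>i. d i * d i) [0..<n]))"
    unfolding singular_values_def by presburger
  then have "singular_values (mat_diag n d) = mset (map (\<lambda>i. sqrt (d i * d i)) [0..<n])"
    by (simp add: image_mset.compositionality o_def)
  then have "nuclear_norm (mat_diag n d) = (\<Sum>i\<leftarrow>[0..<n]. sqrt (d i * d i))"
    by (simp add: nuclear_norm_def flip: sum_mset_sum_list)
  also have "\<dots> = (\<Sum>i<n. d i)"
    using d by (auto simp: interv_sum_list_conv_sum_set_nat lessThan_atLeast0 intro!: sum.cong)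
  finally show ?thesis .
qed

lemma trace_mat_mult_mat_diag:
  assumes "A \<in> carrier_mat n n"
  shows "trace_mat (A * mat_diag n d) = (\<Sum>i<n. A $$ (i, i) * d i)"
  using assms by (simp add: trace_mat_eq_sum[of _ n] mat_diag_mult_right[of _ n])

lemma real_unitary_mat_row_square_sum:
  assumes "real_unitary_mat n W" "i < n"
  shows "(\<Sum>j<n. (W $$ (i, j))\<^sup>2) = 1"
proof -
  have W: "W \<in> carrier_mat n n" "W * W\<^sup>T = 1\<^sub>m n" using assms by (auto simp: real_unitary_mat_def)
  have "(W * W\<^sup>T) $$ (i, i) = (\<Sum>j<n. (W $$ (i, j))\<^sup>2)"
    using W(1) assms(2) by (auto simp: scalar_prod_def power2_eq_square lessThan_atLeast0 intro!: sum.cong)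
  then show ?thesis using W assms(2) by simp
qed

lemma real_unitary_mat_entry_le:
  assumes W: "real_unitary_mat n W" and ij: "i < n" "j < n" "i \<noteq> j"
  shows "(W $$ (i, i))\<^sup>2 + (W $$ (i, j))\<^sup>2 \<le> 1"
proof -
  have "(\<Sum>k\<in>{i, j}. (W $$ (i, k))\<^sup>2) \<le> (\<Sum>k<n. (W $$ (i, k))\<^sup>2)"
    using ij by (intro sum_mono2) auto
  then show ?thesis using real_unitary_mat_row_square_sum[OF W ij(1)] ij by simp
qed

lemma real_unitary_mat_abs_entry_le_1:
  assumes W: "real_unitary_mat n W" and ij: "i < n" "j < n"
  shows "\<bar>W $$ (i, j)\<bar> \<le> 1"
proof -
  have "(\<Sum>k\<in>{j}. (W $$ (i, k))\<^sup>2) \<le> (\<Sum>k<n. (W $$ (i, k))\<^sup>2)"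
    using ij by (intro sum_mono2) auto
  then have "(W $$ (i, j))\<^sup>2 \<le> 1" using real_unitary_mat_row_square_sum[OF W ij(1)] by simp
  then show ?thesis by (simp add: abs_square_le_1)
qed

lemma trace_mat_of_svd:
  assumes "U \<in> carrier_mat n n" "V \<in> carrier_mat n n"
  shows "trace_mat (U * mat_diag n d * V\<^sup>T) = (\<Sum>i<n. (V\<^sup>T * U) $$ (i, i) * d i)"
proof -
  have "trace_mat (U * mat_diag n d * V\<^sup>T) = trace_mat (V\<^sup>T * (U * mat_diag n d))"
    using assms by (intro trace_mat_comm[of _ n n]) auto
  also have "V\<^sup>T * (U * mat_diag n d) = V\<^sup>T * U * mat_diag n d"
    using assms by (simp add: square_mat_assoc[where n = n])
  finally show ?thesis using assms by (subst (asm) trace_mat_mult_mat_diag) auto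
qed

lemma nuclear_norm_of_svd:
  assumes "real_unitary_mat n U" "real_unitary_mat n V" "\<And>i. d i \<ge> 0"
  shows "nuclear_norm (U * mat_diag n d * V\<^sup>T) = (\<Sum>i<n. d i)"
  using assms by (simp add: nuclear_norm_unitary_invariant nuclear_norm_mat_diag)

text \<open>
  With \<open>M = U diag(d) V\<^sup>T\<close> the trace is the sum of the \<open>d\<^sub>i\<close> weighted by the diagonal entries of the
  orthogonal matrix \<open>V\<^sup>T U\<close>, and these are at most 1.
\<close>

lemma trace_mat_le_nuclear_norm:
  assumes M: "M \<in> carrier_mat n n"
  shows "trace_mat M \<le> nuclear_norm M"
proof -
  obtain U V d where UV: "real_unitary_mat n U" "real_unitary_mat n V" and d: "\<And>i. d i \<ge> 0"
    and M_eq: "M = U * mat_diag n d * V\<^sup>T"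
    using real_singular_value_decomposition[OF M] by metis
  have c: "U \<in> carrier_mat n n" "V \<in> carrier_mat n n" using UV by (auto simp: real_unitary_mat_def)
  have W: "real_unitary_mat n (V\<^sup>T * U)"
    by (intro real_unitary_mat_mult real_unitary_mat_transpose UV)
  have "(V\<^sup>T * U) $$ (i, i) * d i \<le> d i" if "i < n" for i
    using mult_right_mono[of "(V\<^sup>T * U) $$ (i, i)" 1 "d i"]
      real_unitary_mat_abs_entry_le_1[OF W that that] d[of i] by linarith
  then show ?thesis
    unfolding M_eq trace_mat_of_svd[OF c] nuclear_norm_of_svd[OF UV d]
    by (intro sum_mono) auto
qed

text \<open>
  The nuclear norm is the maximum of \<open>tr (W M)\<close> over the orthogonal matrices \<open>W\<close>; the polar factor
  \<open>V U\<^sup>T\<close> attains it. This linearizes the nuclear norm at \<open>M\<close>.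
\<close>

lemma nuclear_norm_attained:
  assumes M: "M \<in> carrier_mat n n"
  obtains W where "real_unitary_mat n W" "trace_mat (W * M) = nuclear_norm M"
proof -
  obtain U V d where UV: "real_unitary_mat n U" "real_unitary_mat n V" and d: "\<And>i. d i \<ge> 0"
    and M_eq: "M = U * mat_diag n d * V\<^sup>T"
    using real_singular_value_decomposition[OF M] by metis
  have c: "U \<in> carrier_mat n n" "V \<in> carrier_mat n n" "U\<^sup>T * U = 1\<^sub>m n" "V\<^sup>T * V = 1\<^sub>m n"
    using UV by (auto simp: real_unitary_mat_def)
  have "real_unitary_mat n (V * U\<^sup>T)"
    by (intro real_unitary_mat_mult real_unitary_mat_transpose UV)
  moreover have "V * U\<^sup>T * M = V * (U\<^sup>T * U) * mat_diag n d * V\<^sup>T"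
    unfolding M_eq using c(1,2) by (simp add: square_mat_assoc[where n = n])
  then have "trace_mat (V * U\<^sup>T * M) = nuclear_norm M"
    unfolding M_eq nuclear_norm_of_svd[OF UV d] using c by (simp add: trace_mat_of_svd)
  ultimately show ?thesis using that by blast
qed

text \<open>
  The equality case of \<open>tr M \<le> \<parallel>M\<parallel>\<^sub>*\<close>. Every \<open>d\<^sub>i \<noteq> 0\<close> must carry
  the weight 1, so the \<open>i\<close>-th column of the orthogonal matrix \<open>V\<^sup>T U\<close> is the \<open>i\<close>-th unit vector. Hence
  \<open>U\<close> and \<open>V\<close> agree on the columns that matter, and \<open>M\<close> is symmetric positive semidefinite.
\<close>

lemma trace_mat_eq_nuclear_norm_imp_psd:
  assumes M: "M \<in> carrier_mat n n" and eq: "nuclear_norm M \<le> trace_mat M"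
  obtains V d where "real_unitary_mat n V" "\<And>i. d i \<ge> 0" "M = V * mat_diag n d * V\<^sup>T"
proof -
  obtain U V d where UV: "real_unitary_mat n U" "real_unitary_mat n V" and d: "\<And>i. d i \<ge> 0"
    and M_eq: "M = U * mat_diag n d * V\<^sup>T"
    using real_singular_value_decomposition[OF M] by metis
  have c: "U \<in> carrier_mat n n" "V \<in> carrier_mat n n" "V * V\<^sup>T = 1\<^sub>m n"
    using UV by (auto simp: real_unitary_mat_def)
  define W where "W = V\<^sup>T * U"
  have W: "real_unitary_mat n W" unfolding W_def
    by (intro real_unitary_mat_mult real_unitary_mat_transpose UV)
  then have Wc: "W \<in> carrier_mat n n" by (simp add: real_unitary_mat_def)
  have le: "W $$ (i, i) \<le> 1" if "i < n" for i
    using real_unitary_mat_abs_entry_le_1[OF W that that] by linarith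
  have "(\<Sum>i<n. (1 - W $$ (i, i)) * d i) = nuclear_norm M - trace_mat M"
    unfolding M_eq trace_mat_of_svd[OF c(1,2)] nuclear_norm_of_svd[OF UV d] W_def[symmetric]
    by (simp add: sum_subtractf left_diff_distrib)
  moreover have nonneg: "(1 - W $$ (i, i)) * d i \<ge> 0" if "i < n" for i using le[OF that] d[of i] by simp
  ultimately have "(\<Sum>i<n. (1 - W $$ (i, i)) * d i) = 0"
    using eq sum_nonneg[of "{..<n}" "\<lambda>i. (1 - W $$ (i, i)) * d i"] by force
  then have "\<forall>i\<in>{..<n}. (1 - W $$ (i, i)) * d i = 0"
    by (rule sum_nonneg_eq_0_iff[THEN iffD1, rotated 2]) (use nonneg in auto)
  then have diag: "W $$ (i, i) = 1" if "i < n" "d i \<noteq> 0" for i using that by auto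
  \<comment> \<open>\<open>W\<^sub>j\<^sub>j = 1\<close> leaves no room for other nonzero entries in column \<open>j\<close>, which has length 1.\<close>
  have "W * mat_diag n d = mat_diag n d"
  proof (rule eq_matI)
    fix i j assume "i < dim_row (mat_diag n d)" "j < dim_col (mat_diag n d)"
    then have ij: "i < n" "j < n" by (auto simp: mat_diag_def)
    have "W $$ (i, j) * d j = (if i = j then d j else 0)"
    proof (cases "d j = 0 \<or> i = j")
      case True
      then show ?thesis using diag[of j] ij by auto
    next
      case False
      have "(W\<^sup>T $$ (j, j))\<^sup>2 + (W\<^sup>T $$ (j, i))\<^sup>2 \<le> 1"
        using False ij by (intro real_unitary_mat_entry_le[OF real_unitary_mat_transpose[OF W]]) auto
      then have "W $$ (i, j) = 0" using Wc ij diag[of j] False by simp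
      then show ?thesis using False by simp
    qed
    then show "(W * mat_diag n d) $$ (i, j) = mat_diag n d $$ (i, j)"
      using ij Wc by (simp add: mat_diag_mult_right[of _ n]) (simp add: mat_diag_def)
  qed (use Wc in \<open>auto simp: mat_diag_def\<close>)
  then have "V * (W * mat_diag n d) * V\<^sup>T = V * mat_diag n d * V\<^sup>T" by simp
  moreover have "V * (W * mat_diag n d) * V\<^sup>T = (V * V\<^sup>T) * U * mat_diag n d * V\<^sup>T"
    unfolding W_def using c(1,2) by (simp add: square_mat_assoc[where n = n])
  ultimately have "M = V * mat_diag n d * V\<^sup>T"
    unfolding M_eq using c by simp
  then show ?thesis using that UV d by blast
qed

text \<open>
  The converse of the equality case. Let \<open>W\<close> be an orthogonal matrix with \<open>tr (W N) = \<parallel>N\<parallel>\<^sub>*\<close>. Since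
  \<open>N\<close> is positive semidefinite, so is \<open>(1 - W) N (1 - W)\<^sup>T\<close>, and the trace of this matrix is
  \<open>2 tr N - 2 tr (W N)\<close>. This avoids diagonalizing \<open>N\<close>.
\<close>

lemma nuclear_norm_psd:
  assumes N: "N \<in> carrier_mat n n" and sym: "N\<^sup>T = N"
    and psd: "\<And>x. (\<Sum>i<n. \<Sum>j<n. x i * N $$ (i, j) * x j) \<ge> 0"
  shows "nuclear_norm N = trace_mat N"
proof (rule antisym)
  obtain W where W: "real_unitary_mat n W" and tr: "trace_mat (W * N) = nuclear_norm N"
    using nuclear_norm_attained[OF N] by metis
  have Wc: "W \<in> carrier_mat n n" "W\<^sup>T * W = 1\<^sub>m n" using W by (auto simp: real_unitary_mat_def)
  define K where "K = 1\<^sub>m n - W"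
  have K: "K \<in> carrier_mat n n" using Wc by (simp add: K_def minus_carrier_mat)
  have Kt: "K\<^sup>T = 1\<^sub>m n - W\<^sup>T" unfolding K_def using Wc by (intro eq_matI) auto
  have form: "trace_mat (B * N * B\<^sup>T) = (\<Sum>k<n. \<Sum>i<n. \<Sum>j<n. B $$ (k, i) * N $$ (i, j) * B $$ (k, j))"
    if B: "B \<in> carrier_mat n n" for B
  proof -
    have "(B * N * B\<^sup>T) $$ (k, k) = (\<Sum>i<n. \<Sum>j<n. B $$ (k, i) * N $$ (i, j) * B $$ (k, j))"
      if k: "k < n" for k
    proof -
      have "(B * N * B\<^sup>T) $$ (k, k) = (\<Sum>i<n. B $$ (k, i) * (\<Sum>j<n. N $$ (i, j) * B $$ (k, j)))"
        using B N k by (auto simp: scalar_prod_def lessThan_atLeast0 intro!: sum.cong)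
      then show ?thesis by (simp add: sum_distrib_left mult.assoc)
    qed
    then show ?thesis using B N by (subst trace_mat_eq_sum[of _ n]) auto
  qed
  have ge: "0 \<le> trace_mat (K * N * K\<^sup>T)"
    unfolding form[OF K] by (intro sum_nonneg psd)
  have "K * N * K\<^sup>T = N - W * N - N * W\<^sup>T + W * N * W\<^sup>T"
  proof -
    have "K * N = N - W * N" unfolding K_def using Wc N by (simp add: minus_mult_distrib_mat[of _ n n])
    moreover have "(N - W * N) * (1\<^sub>m n - W\<^sup>T) = (N - W * N) * 1\<^sub>m n - (N - W * N) * W\<^sup>T"
      by (rule mult_minus_distrib_mat[of _ n n _ n]) (use Wc N in \<open>auto intro!: minus_carrier_mat\<close>)
    ultimately have "K * N * K\<^sup>T = (N - W * N) * 1\<^sub>m n - (N - W * N) * W\<^sup>T"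
      unfolding Kt by simp
    also have "(N - W * N) * W\<^sup>T = N * W\<^sup>T - W * N * W\<^sup>T"
      using Wc N by (simp add: minus_mult_distrib_mat[of _ n n])
    finally show ?thesis using Wc N by (intro eq_matI) auto
  qed
  moreover have "trace_mat (N - W * N - N * W\<^sup>T + W * N * W\<^sup>T)
      = trace_mat N - trace_mat (W * N) - trace_mat (N * W\<^sup>T) + trace_mat (W * N * W\<^sup>T)"
    using Wc(1) N
    by (simp add: trace_mat_add[of _ n] trace_mat_minus[of _ n] minus_carrier_mat mult_carrier_mat[of _ n n _ n])
  ultimately have "0 \<le> trace_mat N - trace_mat (W * N) - trace_mat (N * W\<^sup>T) + trace_mat (W * N * W\<^sup>T)"
    using ge by simp
  moreover have "trace_mat (W * N * W\<^sup>T) = trace_mat N"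
  proof -
    have "trace_mat (W * N * W\<^sup>T) = trace_mat (W\<^sup>T * (W * N))"
      by (rule trace_mat_comm[of _ n n]) (use Wc N in auto)
    moreover have "W\<^sup>T * (W * N) = (W\<^sup>T * W) * N"
      using Wc(1) N by (simp add: square_mat_assoc[where n = n])
    ultimately show ?thesis using Wc N by simp
  qed
  moreover have "trace_mat (N * W\<^sup>T) = trace_mat (W * N)"
  proof -
    have "(W * N)\<^sup>T = N * W\<^sup>T" using transpose_mult[OF Wc(1) N] sym by simp
    moreover have "trace_mat (W * N)\<^sup>T = trace_mat (W * N)"
      using Wc(1) N by (intro trace_mat_transpose[of _ n]) auto
    ultimately show ?thesis by simp
  qed
  ultimately show "nuclear_norm N \<le> trace_mat N" using tr by simp
qed (rule trace_mat_le_nuclear_norm[OF N])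

section \<open>Perturbations of a nonnegative diagonal matrix\<close>

text \<open>
  With \<open>a\<^sub>i = N\<^sub>i\<^sub>i x\<^sub>i\<^sup>2\<close>, the hypothesis and the inequality of arithmetic and geometric means bound
  each off-diagonal term by \<open>(a\<^sub>i + a\<^sub>j) / (2 n)\<close>; together they cannot outweigh the diagonal. The
  scale-invariant form of the hypothesis matters: below, some diagonal entries of \<open>N\<close> tend to 0
  while others do not.
\<close>

lemma scaled_diagonally_dominant_imp_psd:
  fixes N :: "nat \<Rightarrow> nat \<Rightarrow> real"
  assumes diag: "\<And>i. i < n \<Longrightarrow> N i i \<ge> 0"
    and off: "\<And>i j. i < n \<Longrightarrow> j < n \<Longrightarrow> i \<noteq> j \<Longrightarrow> (real n * N i j)\<^sup>2 \<le> N i i * N j j"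
  shows "(\<Sum>i<n. \<Sum>j<n. x i * N i j * x j) \<ge> 0"
proof (cases "n = 0")
  case False
  define a where "a i = N i i * (x i)\<^sup>2" for i
  have a: "a i \<ge> 0" if "i < n" for i using diag[OF that] by (simp add: a_def)
  have entry: "(if i = j then n * a i else 0) - (a i + a j) / 2 \<le> n * (x i * N i j * x j)"
    if ij: "i < n" "j < n" for i j
  proof (cases "i = j")
    case True
    then show ?thesis using a[OF ij(1)] by (simp add: a_def power2_eq_square mult_ac)
  next
    case False
    have "(n * (x i * N i j * x j))\<^sup>2 = (real n * N i j)\<^sup>2 * ((x i)\<^sup>2 * (x j)\<^sup>2)"
      by (simp add: power_mult_distrib)
    also have "\<dots> \<le> N i i * N j j * ((x i)\<^sup>2 * (x j)\<^sup>2)"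
      using off[OF ij False] by (intro mult_right_mono) auto
    also have "\<dots> = a i * a j" by (simp add: a_def)
    also have "\<dots> \<le> ((a i + a j) / 2)\<^sup>2"
      using zero_le_power2[of "a i - a j"] by (simp add: power2_eq_square algebra_simps)
    finally have "\<bar>n * (x i * N i j * x j)\<bar> \<le> (a i + a j) / 2"
      using a[OF ij(1)] a[OF ij(2)] by (simp add: abs_le_square_iff[symmetric])
    then have "- ((a i + a j) / 2) \<le> n * (x i * N i j * x j)" by linarith
    then show ?thesis using False by simp
  qed
  have "0 = (\<Sum>i<n. \<Sum>j<n. (if i = j then n * a i else 0) - (a i + a j) / 2)"
    by (simp add: sum_subtractf sum.distrib sum_divide_distrib[symmetric] sum_distrib_left[symmetric])
  also have "\<dots> \<le> (\<Sum>i<n. \<Sum>j<n. n * (x i * N i j * x j))"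
    by (intro sum_mono entry) auto
  also have "\<dots> = n * (\<Sum>i<n. \<Sum>j<n. x i * N i j * x j)"
    by (simp add: sum_distrib_left)
  finally show ?thesis using False by (simp add: zero_le_mult_iff)
qed simp

lemma index_eigendecomposition:
  fixes V :: "real mat"
  assumes "V \<in> carrier_mat n n" "i < n" "j < n"
  shows "(V * mat_diag n d * V\<^sup>T) $$ (i, j) = (\<Sum>k<n. d k * V $$ (i, k) * V $$ (j, k))"
proof -
  have "V * mat_diag n d * V\<^sup>T = mat n n (\<lambda>(i, j). V $$ (i, j) * d j) * V\<^sup>T"
    using assms by (simp add: mat_diag_mult_right[of _ n] del: assoc_mult_mat)
  then show ?thesis using assms
    by (auto simp: scalar_prod_def lessThan_atLeast0 intro!: sum.cong)
qed

lemma trace_mat_diag_add_smult: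
  fixes Q :: "real mat"
  assumes "Q \<in> carrier_mat n n"
  shows "trace_mat (mat_diag n x + t \<cdot>\<^sub>m Q) = (\<Sum>i<n. x i) + t * trace_mat Q"
proof -
  have "trace_mat (mat_diag n x) = (\<Sum>i<n. x i)"
    by (subst trace_mat_eq_sum[of _ n]) (auto simp: mat_diag_def)
  then show ?thesis using assms by (simp add: trace_mat_add[of _ n] trace_mat_smult[of _ n])
qed

text \<open>
  Here \<open>tr (diag(x) + Q) \<ge> tr diag(x) = \<parallel>diag(x)\<parallel>\<^sub>* \<ge> \<parallel>diag(x) + Q\<parallel>\<^sub>*\<close>, so the trace inequality
  is an equality and \<open>diag(x) + Q\<close> is positive semidefinite. A positive semidefinite matrix is
  symmetric, and a zero on its diagonal forces a zero column.
\<close>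

lemma nuclear_norm_not_increased_imp_psd:
  assumes x: "\<And>i. i < n \<Longrightarrow> x i \<ge> 0" and Q: "Q \<in> carrier_mat n n"
    and tr: "trace_mat Q \<ge> 0" and le: "nuclear_norm (mat_diag n x + Q) \<le> nuclear_norm (mat_diag n x)"
  shows "trace_mat Q = 0" and "Q\<^sup>T = Q"
    and "\<And>i j. i < n \<Longrightarrow> j < n \<Longrightarrow> i \<noteq> j \<Longrightarrow> x j = 0 \<Longrightarrow> Q $$ (j, j) = 0 \<Longrightarrow> Q $$ (i, j) = 0"
proof -
  let ?M = "mat_diag n x + Q"
  have M: "?M \<in> carrier_mat n n" using Q by simp
  have trM: "trace_mat ?M = (\<Sum>i<n. x i) + trace_mat Q"
  proof -
    have "1 \<cdot>\<^sub>m Q = Q" by (rule eq_matI) auto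
    then show ?thesis using trace_mat_diag_add_smult[OF Q, of x 1] by simp
  qed
  show tr0: "trace_mat Q = 0"
    using trace_mat_le_nuclear_norm[OF M] tr le trM nuclear_norm_mat_diag[of n x] x by simp
  have "nuclear_norm ?M \<le> trace_mat ?M"
    using le trM tr0 nuclear_norm_mat_diag[of n x] x by simp
  from trace_mat_eq_nuclear_norm_imp_psd[OF M this] obtain V d
    where V: "real_unitary_mat n V" and d: "\<And>i. d i \<ge> 0" and eq: "?M = V * mat_diag n d * V\<^sup>T" by metis
  have Vc: "V \<in> carrier_mat n n" using V by (simp add: real_unitary_mat_def)
  have entry: "?M $$ (i, j) = (\<Sum>k<n. d k * V $$ (i, k) * V $$ (j, k))" if "i < n" "j < n" for i j
    unfolding eq by (rule index_eigendecomposition[OF Vc that])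
  have Mij: "?M $$ (i, j) = (if i = j then x i else 0) + Q $$ (i, j)" if "i < n" "j < n" for i j
    using that Q by (simp add: mat_diag_def)
  show "Q\<^sup>T = Q"
  proof (rule eq_matI)
    fix i j assume "i < dim_row Q" "j < dim_col Q"
    then have ij: "i < n" "j < n" using Q by auto
    have "?M $$ (i, j) = ?M $$ (j, i)" unfolding entry[OF ij] entry[OF ij(2,1)]
      by (simp add: mult_ac)
    then show "Q\<^sup>T $$ (i, j) = Q $$ (i, j)" unfolding Mij[OF ij] Mij[OF ij(2,1)]
      using ij Q by (auto split: if_splits)
  qed (use Q in auto)
  fix i j assume ij: "i < n" "j < n" "i \<noteq> j" and 0: "x j = 0" "Q $$ (j, j) = 0"
  have "(\<Sum>k<n. d k * V $$ (j, k) * V $$ (j, k)) = 0"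
    using entry[OF ij(2) ij(2)] Mij[OF ij(2) ij(2)] 0 by simp
  then have "d k * V $$ (j, k) * V $$ (j, k) = 0" if "k < n" for k
    using that d by (subst (asm) sum_nonneg_eq_0_iff) (auto simp: mult.assoc)
  then have "d k * V $$ (i, k) * V $$ (j, k) = 0" if "k < n" for k using that by fastforce
  then have "?M $$ (i, j) = 0" unfolding entry[OF ij(1,2)] by (intro sum.neutral) auto
  then show "Q $$ (i, j) = 0" using Mij[OF ij(1,2)] ij(3) by simp
qed

text \<open>
  The matrix \<open>diag(x) + t Q\<close> is positive semidefinite for small \<open>t > 0\<close> by scaled diagonal
  dominance. Its upper left block tends to a positive diagonal matrix. An entry \<open>t Q\<^sub>i\<^sub>j\<close> of the upper
  right block has a square of order \<open>t\<^sup>2\<close>, which is dominated by the product of the diagonal entries,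
  of order \<open>t\<close>, unless \<open>Q\<^sub>j\<^sub>j = 0\<close>; in that case the entry vanishes by the last hypothesis.
\<close>

lemma nuclear_norm_eq_trace_near_diagonal:
  fixes Q :: "real mat"
  assumes Q: "Q \<in> carrier_mat n n" and sym: "Q\<^sup>T = Q"
    and x_pos: "\<And>i. i < r \<Longrightarrow> x i > 0" and x_0: "\<And>i. r \<le> i \<Longrightarrow> x i = 0"
    and off: "\<And>i j. r \<le> i \<Longrightarrow> r \<le> j \<Longrightarrow> i < n \<Longrightarrow> j < n \<Longrightarrow> i \<noteq> j \<Longrightarrow> Q $$ (i, j) = 0"
    and diag: "\<And>i. r \<le> i \<Longrightarrow> i < n \<Longrightarrow> Q $$ (i, i) \<ge> 0"
    and supp: "\<And>i j. i < r \<Longrightarrow> i < n \<Longrightarrow> r \<le> j \<Longrightarrow> j < n \<Longrightarrow> Q $$ (j, j) = 0 \<Longrightarrow> Q $$ (i, j) = 0"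
  obtains t where "t > 0"
    "nuclear_norm (mat_diag n x + t \<cdot>\<^sub>m Q) = trace_mat (mat_diag n x + t \<cdot>\<^sub>m Q)"
proof -
  have Q_sym: "Q $$ (i, j) = Q $$ (j, i)" if "i < n" "j < n" for i j
    using arg_cong[OF sym, of "\<lambda>A. A $$ (i, j)"] Q that by simp
  define N where "N t i j = (if i = j then x i else 0) + t * Q $$ (i, j)" for t i j
  have N_lim: "((\<lambda>t. N t i j) \<longlongrightarrow> (if i = j then x i else 0)) (at_right 0)" for i j
    unfolding N_def by (auto intro!: tendsto_eq_intros)
  have t_pos: "\<forall>\<^sub>F t in at_right (0::real). t > 0" by (simp add: eventually_at_right_less)
  have ev_diag: "\<forall>\<^sub>F t in at_right 0. N t i i \<ge> 0" if i: "i < n" for i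
  proof (cases "i < r")
    case True
    have "((\<lambda>t. N t i i) \<longlongrightarrow> x i) (at_right 0)"
      using N_lim[of i i] by simp
    then have "\<forall>\<^sub>F t in at_right 0. N t i i > 0" using x_pos[OF True] by (rule order_tendstoD)
    then show ?thesis by eventually_elim simp
  next
    case False
    show ?thesis using t_pos by eventually_elim (use False i diag x_0 in \<open>auto simp: N_def\<close>)
  qed
  \<comment> \<open>The pairs with \<open>i < r\<close>; those with \<open>j < r\<close> follow by symmetry, and in the remaining block the
    off-diagonal entries vanish.\<close>
  have top: "\<forall>\<^sub>F t in at_right 0. (real n * N t i j)\<^sup>2 \<le> N t i i * N t j j"
    if i: "i < n" "i < r" and j: "j < n" and ij: "i \<noteq> j" for i j
  proof (cases "j < r")
    case True
    have "((\<lambda>t. N t i i * N t j j - (real n * N t i j)\<^sup>2) \<longlongrightarrow> x i * x j) (at_right 0)"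
      using tendsto_diff[OF tendsto_mult[OF N_lim[of i i] N_lim[of j j]]
          tendsto_power[OF tendsto_mult[OF tendsto_const N_lim[of i j]]], of "real n" 2] ij by simp
    moreover have "x i * x j > 0" using x_pos i True by simp
    ultimately have "\<forall>\<^sub>F t in at_right 0. N t i i * N t j j - (real n * N t i j)\<^sup>2 > 0"
      by (rule order_tendstoD)
    then show ?thesis by eventually_elim simp
  next
    case j_r: False
    show ?thesis
    proof (cases "Q $$ (j, j) = 0")
      case True
      then show ?thesis using supp[of i j] i j j_r ij x_0[of j] by (simp add: N_def)
    next
      case False
      have "((\<lambda>t. N t i i * Q $$ (j, j) - t * (real n * Q $$ (i, j))\<^sup>2) \<longlongrightarrow> x i * Q $$ (j, j)) (at_right 0)"
        using tendsto_diff[OF tendsto_mult[OF N_lim[of i i] tendsto_const]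
            tendsto_mult[OF tendsto_ident_at tendsto_const]] by simp
      moreover have "x i * Q $$ (j, j) > 0" using x_pos[OF i(2)] diag[of j] j j_r False by simp
      ultimately have "\<forall>\<^sub>F t in at_right 0. N t i i * Q $$ (j, j) - t * (real n * Q $$ (i, j))\<^sup>2 > 0"
        by (rule order_tendstoD)
      then show ?thesis using t_pos
      proof eventually_elim
        case (elim t)
        \<comment> \<open>Both sides of the claim are divisible by \<open>t\<close>; the quotient has a positive limit.\<close>
        have "0 \<le> t * (N t i i * Q $$ (j, j) - t * (real n * Q $$ (i, j))\<^sup>2)"
          using elim by simp
        also have "\<dots> = N t i i * N t j j - (real n * N t i j)\<^sup>2"
          using ij j_r x_0[of j] by (simp add: N_def power2_eq_square algebra_simps)
        finally show ?case by simp
      qed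
    qed
  qed
  have ev_off: "\<forall>\<^sub>F t in at_right 0. (real n * N t i j)\<^sup>2 \<le> N t i i * N t j j"
    if ij: "i < n" "j < n" "i \<noteq> j" for i j
  proof -
    consider "i < r" | "j < r" | "r \<le> i" "r \<le> j" by linarith
    then show ?thesis
    proof cases
      case 1
      then show ?thesis using top ij by blast
    next
      case 2
      then have "\<forall>\<^sub>F t in at_right 0. (real n * N t j i)\<^sup>2 \<le> N t j j * N t i i"
        using top[of j i] ij by auto
      moreover have "N t j i = N t i j" for t using Q_sym[of i j] ij by (simp add: N_def)
      ultimately show ?thesis by (simp add: mult.commute)
    next
      case 3
      show ?thesis using t_pos
        by eventually_elim (use 3 ij off diag x_0 in \<open>simp add: N_def\<close>)
    qed
  qed
  have "\<forall>\<^sub>F t in at_right 0. t > 0 \<and> (\<forall>i\<in>{..<n}. N t i i \<ge> 0) \<and>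
      (\<forall>i\<in>{..<n}. \<forall>j\<in>{..<n}. i \<noteq> j \<longrightarrow> (real n * N t i j)\<^sup>2 \<le> N t i i * N t j j)"
  proof (intro eventually_conj t_pos eventually_ball_finite ballI finite_lessThan)
    fix i j assume "i \<in> {..<n}" "j \<in> {..<n}"
    then show "\<forall>\<^sub>F t in at_right 0. i \<noteq> j \<longrightarrow> (real n * N t i j)\<^sup>2 \<le> N t i i * N t j j"
      using ev_off[of i j] by (cases "i = j") auto
  qed (use ev_diag in auto)
  then obtain t where t: "t > 0" and d: "\<And>i. i < n \<Longrightarrow> N t i i \<ge> 0"
    and o: "\<And>i j. i < n \<Longrightarrow> j < n \<Longrightarrow> i \<noteq> j \<Longrightarrow> (real n * N t i j)\<^sup>2 \<le> N t i i * N t j j"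
    by (auto dest!: eventually_happens'[OF trivial_limit_at_right_real])
  let ?M = "mat_diag n x + t \<cdot>\<^sub>m Q"
  have Mij: "?M $$ (i, j) = N t i j" if "i < n" "j < n" for i j
    using that Q by (simp add: mat_diag_def N_def)
  have "nuclear_norm ?M = trace_mat ?M"
  proof (rule nuclear_norm_psd)
    show "?M \<in> carrier_mat n n" using Q by simp
    show "?M\<^sup>T = ?M"
    proof (rule eq_matI)
      fix i j assume "i < dim_row ?M" "j < dim_col ?M"
      then have ij: "i < n" "j < n" using Q by auto
      then show "?M\<^sup>T $$ (i, j) = ?M $$ (i, j)"
        using Q Q_sym[OF ij] by (simp add: mat_diag_def)
    qed (use Q in auto)
    show "(\<Sum>i<n. \<Sum>j<n. y i * ?M $$ (i, j) * y j) \<ge> 0" for y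
      using scaled_diagonally_dominant_imp_psd[of n "N t" y, OF d o] by (simp add: Mij)
  qed
  then show ?thesis using that t by blast
qed

text \<open>
  The right derivative of \<open>t \<mapsto> \<parallel>diag(x) + t Q\<parallel>\<^sub>*\<close> at 0 is \<open>tr Q\<close>. For the upper bound that is
  wanted here, write the norm as \<open>tr (W diag(x)) + t tr (W Q)\<close> with \<open>W\<close> orthogonal. If the norm did
  not decrease, the first summand would have to be nearly as large as \<open>tr diag(x)\<close>, which forces
  \<open>W\<^sub>i\<^sub>i\<close> to be close to 1 for \<open>i < r\<close>. As the rows and columns of \<open>W\<close> have length 1, the other entries
  in these rows and columns are then close to 0. In the remaining block \<open>Q\<close> is diagonal and
  nonnegative, and there \<open>W\<^sub>i\<^sub>i \<le> 1\<close> suffices. So \<open>tr (W Q)\<close> exceeds \<open>tr Q\<close> by little and is negative,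
  a contradiction.
\<close>

lemma nuclear_norm_descent:
  fixes Q :: "real mat"
  assumes Q: "Q \<in> carrier_mat n n" and tr: "trace_mat Q < 0"
    and x_pos: "\<And>i. i < r \<Longrightarrow> x i > 0" and x_0: "\<And>i. r \<le> i \<Longrightarrow> x i = 0"
    and off: "\<And>i j. r \<le> i \<Longrightarrow> r \<le> j \<Longrightarrow> i < n \<Longrightarrow> j < n \<Longrightarrow> i \<noteq> j \<Longrightarrow> Q $$ (i, j) = 0"
    and diag: "\<And>i. r \<le> i \<Longrightarrow> i < n \<Longrightarrow> Q $$ (i, i) \<ge> 0"
  obtains t where "t > 0" "nuclear_norm (mat_diag n x + t \<cdot>\<^sub>m Q) < nuclear_norm (mat_diag n x)"
proof -
  \<comment> \<open>A positive lower bound for the entries \<open>x\<^sub>i\<close> with \<open>i < r\<close>; the 1 covers \<open>r = 0\<close>.\<close>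
  define l where "l = Min (insert 1 (x ` {..<r}))"
  have l: "l > 0" using x_pos by (auto simp: l_def)
  have l_le: "l \<le> x i" if "i < r" for i unfolding l_def using that by (intro Min_le) auto
  have x: "x i \<ge> 0" for i using x_pos[of i] x_0[of i] by (cases "i < r") auto
  define s where "s = 1 + (\<Sum>i<n. \<Sum>j<n. \<bar>Q $$ (j, i)\<bar>)"
  have s: "s \<ge> 1" by (simp add: s_def sum_nonneg)
  define \<tau> where "\<tau> = - trace_mat Q"
  have \<tau>: "\<tau> > 0" using tr by (simp add: \<tau>_def)
  \<comment> \<open>Small enough for \<open>sqrt (2 \<delta>) * s \<le> \<tau> / 2\<close>: the off-diagonal entries in the first \<open>r\<close> rows and
    columns of \<open>W\<close> will be at most \<open>sqrt (2 \<delta>)\<close>, and \<open>s\<close> bounds the entries of \<open>Q\<close>.\<close>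
  define \<delta> where "\<delta> = min 1 (\<tau>\<^sup>2 / (8 * s\<^sup>2))"
  have \<delta>: "\<delta> > 0" "\<delta> \<le> 1" using \<tau> s by (auto simp: \<delta>_def)
  define \<epsilon> where "\<epsilon> = sqrt (2 * \<delta>)"
  have "\<delta> \<le> \<tau>\<^sup>2 / (8 * s\<^sup>2)" by (simp add: \<delta>_def)
  also have "\<dots> = (\<tau> / (2 * s))\<^sup>2 / 2" by (simp add: power_divide power_mult_distrib)
  finally have "\<epsilon> \<le> sqrt ((\<tau> / (2 * s))\<^sup>2)"
    unfolding \<epsilon>_def by (intro real_sqrt_le_mono) simp
  then have "\<epsilon> \<le> \<tau> / (2 * s)" using \<tau> s by simp
  then have \<epsilon>_le: "\<epsilon> * s \<le> \<tau> / 2" using s by (simp add: field_simps)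
  have \<epsilon>: "\<epsilon> \<ge> 0" "\<epsilon>\<^sup>2 = 2 * \<delta>" using \<delta> by (auto simp: \<epsilon>_def)
  have \<delta>_le_\<epsilon>: "\<delta> \<le> \<epsilon>"
  proof (rule power2_le_imp_le)
    have "\<delta>\<^sup>2 \<le> \<delta> * 1" unfolding power2_eq_square using \<delta> by (intro mult_left_mono) auto
    then show "\<delta>\<^sup>2 \<le> \<epsilon>\<^sup>2" using \<epsilon> \<delta> by simp
  qed (rule \<epsilon>)
  \<comment> \<open>With this step \<open>t s = \<delta> l\<close>, which will yield \<open>1 - W\<^sub>i\<^sub>i \<le> \<delta>\<close> for \<open>i < r\<close>.\<close>
  define t where "t = \<delta> * l / s"
  have t: "t > 0" using \<delta> l s by (simp add: t_def)
  let ?M = "mat_diag n x + t \<cdot>\<^sub>m Q"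
  have M: "?M \<in> carrier_mat n n" using Q by simp
  obtain W where W: "real_unitary_mat n W" and WM: "trace_mat (W * ?M) = nuclear_norm ?M"
    using nuclear_norm_attained[OF M] by metis
  have Wc: "W \<in> carrier_mat n n" using W by (simp add: real_unitary_mat_def)
  have W_abs: "\<bar>W $$ (i, j)\<bar> \<le> 1" if "i < n" "j < n" for i j
    using real_unitary_mat_abs_entry_le_1[OF W that] .
  have WQ: "trace_mat (W * Q) = (\<Sum>i<n. \<Sum>j<n. W $$ (i, j) * Q $$ (j, i))"
    using Wc Q by (rule trace_mat_mult_eq_sum)
  have "W * ?M = W * mat_diag n x + t \<cdot>\<^sub>m (W * Q)"
    using Wc Q by (simp add: mult_add_distrib_mat[of _ n n _ n] mult_smult_distrib[of _ n n _ n])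
  then have nnM: "nuclear_norm ?M = (\<Sum>i<n. W $$ (i, i) * x i) + t * trace_mat (W * Q)"
    using WM Wc Q by (simp add: trace_mat_add[of _ n] trace_mat_smult[of _ n] mult_carrier_mat[of _ n n _ n]
        trace_mat_mult_mat_diag)
  have nnD: "nuclear_norm (mat_diag n x) = (\<Sum>i<n. x i)" using x by (simp add: nuclear_norm_mat_diag)
  have "nuclear_norm ?M < nuclear_norm (mat_diag n x)"
  proof (rule ccontr)
    assume "\<not> ?thesis"
    then have ge: "nuclear_norm ?M \<ge> (\<Sum>i<n. x i)" using nnD by simp
    have entry_le: "W $$ (i, j) * Q $$ (j, i) \<le> \<bar>Q $$ (j, i)\<bar>" if "i < n" "j < n" for i j
    proof -
      have "W $$ (i, j) * Q $$ (j, i) \<le> \<bar>W $$ (i, j)\<bar> * \<bar>Q $$ (j, i)\<bar>"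
        by (metis abs_ge_self abs_mult)
      also have "\<dots> \<le> 1 * \<bar>Q $$ (j, i)\<bar>" using W_abs[OF that] by (intro mult_right_mono) auto
      finally show ?thesis by simp
    qed
    have "trace_mat (W * Q) \<le> (\<Sum>i<n. \<Sum>j<n. \<bar>Q $$ (j, i)\<bar>)"
      unfolding WQ by (intro sum_mono entry_le) auto
    then have "t * trace_mat (W * Q) \<le> t * s" using t by (simp add: s_def)
    also have "t * s = \<delta> * l" using s by (simp add: t_def)
    finally have sum_le: "(\<Sum>i<n. (1 - W $$ (i, i)) * x i) \<le> \<delta> * l"
      using ge nnM by (simp add: left_diff_distrib sum_subtractf)
    have near: "1 - W $$ (i, i) \<le> \<delta>" if i: "i < r" "i < n" for i
    proof -
      have nonneg: "(1 - W $$ (k, k)) * x k \<ge> 0" if "k < n" for k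
        using W_abs[OF that that] x[of k] by simp
      have "(1 - W $$ (i, i)) * l \<le> (1 - W $$ (i, i)) * x i"
        using W_abs[OF i(2) i(2)] l_le[OF i(1)] by (intro mult_left_mono) auto
      also have "\<dots> \<le> (\<Sum>k<n. (1 - W $$ (k, k)) * x k)"
        using i nonneg by (intro member_le_sum) auto
      also have "\<dots> \<le> \<delta> * l" by (rule sum_le)
      finally show ?thesis using l by simp
    qed
    \<comment> \<open>Two entries \<open>a\<close>, \<open>b\<close> of a unit vector: if \<open>a\<close> is close to 1, then \<open>b\<close> is close to 0.\<close>
    have small: "\<bar>b\<bar> \<le> \<epsilon>" if "a\<^sup>2 + b\<^sup>2 \<le> 1" "1 - a \<le> \<delta>" for a b
    proof -
      have "(1 - \<delta>)\<^sup>2 \<le> a\<^sup>2" using that \<delta> by (intro power_mono) auto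
      then have "b\<^sup>2 \<le> 2 * \<delta> - \<delta>\<^sup>2" using that by (simp add: power2_eq_square algebra_simps)
      then have "b\<^sup>2 \<le> \<epsilon>\<^sup>2" using \<epsilon> zero_le_power2[of \<delta>] by linarith
      then show ?thesis using \<epsilon>(1) by (metis abs_le_square_iff abs_of_nonneg)
    qed
    have bound: "W $$ (i, j) * Q $$ (j, i) \<le> (if i = j then Q $$ (i, i) else 0) + \<epsilon> * \<bar>Q $$ (j, i)\<bar>"
      if ij: "i < n" "j < n" for i j
    proof -
      have *: "W $$ (i, j) * Q $$ (j, i) - c * Q $$ (j, i) \<le> \<epsilon> * \<bar>Q $$ (j, i)\<bar>"
        if "\<bar>W $$ (i, j) - c\<bar> \<le> \<epsilon>" for c
      proof -
        have "(W $$ (i, j) - c) * Q $$ (j, i) \<le> \<bar>W $$ (i, j) - c\<bar> * \<bar>Q $$ (j, i)\<bar>"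
          by (metis abs_ge_self abs_mult)
        also have "\<dots> \<le> \<epsilon> * \<bar>Q $$ (j, i)\<bar>" using that by (intro mult_right_mono) auto
        finally show ?thesis by (simp add: left_diff_distrib)
      qed
      consider "i = j" "i < r" | "i = j" "r \<le> i" | "i \<noteq> j" "i < r" | "i \<noteq> j" "j < r"
        | "i \<noteq> j" "r \<le> i" "r \<le> j" by linarith
      then show ?thesis
      proof cases
        case 1
        have "\<bar>W $$ (i, j) - 1\<bar> \<le> \<epsilon>"
          using near[of i] W_abs[OF ij] 1 ij \<delta>_le_\<epsilon> by auto
        then show ?thesis using *[of 1] 1 by simp
      next
        case 2
        then have "W $$ (i, i) * Q $$ (i, i) \<le> 1 * Q $$ (i, i)"
          using W_abs[OF ij] diag[of i] ij by (intro mult_right_mono) auto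
        then show ?thesis using 2 mult_nonneg_nonneg[OF \<epsilon>(1) abs_ge_zero[of "Q $$ (i, i)"]] by simp
      next
        case 3
        have "\<bar>W $$ (i, j)\<bar> \<le> \<epsilon>"
          using small[OF real_unitary_mat_entry_le[OF W ij] near[of i]] 3 ij by simp
        then show ?thesis using *[of 0] 3 by simp
      next
        case 4
        have "\<bar>W\<^sup>T $$ (j, i)\<bar> \<le> \<epsilon>"
          using small[OF real_unitary_mat_entry_le[OF real_unitary_mat_transpose[OF W] ij(2,1)]] near[of j] 4 ij Wc
          by simp
        then show ?thesis using *[of 0] 4 ij Wc by simp
      next
        case 5
        then show ?thesis using off[of j i] ij by simp
      qed
    qed
    have "trace_mat (W * Q) \<le> (\<Sum>i<n. \<Sum>j<n. (if i = j then Q $$ (i, i) else 0) + \<epsilon> * \<bar>Q $$ (j, i)\<bar>)"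
      unfolding WQ by (intro sum_mono bound) auto
    also have "\<dots> = trace_mat Q + \<epsilon> * (s - 1)"
      using Q by (simp add: s_def sum.distrib trace_mat_eq_sum[of _ n] sum_distrib_left)
    also have "\<dots> \<le> - \<tau> + \<tau> / 2" using \<epsilon>_le \<epsilon> by (simp add: \<tau>_def algebra_simps)
    also have "\<dots> < 0" using \<tau> by simp
    finally have "t * trace_mat (W * Q) < 0" using t by (simp add: mult_pos_neg)
    moreover have "(\<Sum>i<n. W $$ (i, i) * x i) \<le> (\<Sum>i<n. x i)"
    proof (rule sum_mono)
      fix i assume "i \<in> {..<n}"
      then have "W $$ (i, i) * x i \<le> 1 * x i"
        using W_abs[of i i] x[of i] by (intro mult_right_mono) auto
      then show "W $$ (i, i) * x i \<le> x i" by simp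
    qed
    ultimately show False using ge nnM by simp
  qed
  then show ?thesis using that t by blast
qed

section \<open>Coordinates from completed orthonormal bases\<close>

lemma real_unitary_mat_cancel:
  assumes P: "real_unitary_mat n P" and R: "real_unitary_mat n R" and A: "A \<in> carrier_mat n n"
  shows "P\<^sup>T * (P * A * R\<^sup>T) * R = A"
proof -
  have c: "P \<in> carrier_mat n n" "R \<in> carrier_mat n n" "P\<^sup>T * P = 1\<^sub>m n" "R\<^sup>T * R = 1\<^sub>m n"
    using P R by (auto simp: real_unitary_mat_def)
  have "P\<^sup>T * (P * A * R\<^sup>T) * R = (P\<^sup>T * P) * A * (R\<^sup>T * R)"
    using c(1,2) A by (simp add: square_mat_assoc[where n = n])
  then show ?thesis using c A by simp
qed

text \<open>
  The completed orthonormal bases turn a compact decomposition into a full one: padding the middle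
  factor with zeros hides the completing columns.
\<close>

lemma append_cols_mult_corner:
  assumes "U \<in> carrier_mat n a" "Ub \<in> carrier_mat n c" "V \<in> carrier_mat m b" "Vb \<in> carrier_mat m d"
    and "L \<in> carrier_mat a b"
  shows "(U @\<^sub>c Ub) * four_block_mat L (0\<^sub>m a d) (0\<^sub>m c b) (0\<^sub>m c d) * (V @\<^sub>c Vb)\<^sup>T = U * L * V\<^sup>T"
proof -
  have UL: "(U @\<^sub>c Ub) * four_block_mat L (0\<^sub>m a d) (0\<^sub>m c b) (0\<^sub>m c d)
      = four_block_mat (U * L) (0\<^sub>m n d) (0\<^sub>m 0 b) (0\<^sub>m 0 d)"
    unfolding append_cols_def using assms
    by (subst mult_four_block_mat[of _ n a _ c _ 0 _ _ b _ d]) auto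
  have V: "(V @\<^sub>c Vb)\<^sup>T = four_block_mat V\<^sup>T (0\<^sub>m b 0) Vb\<^sup>T (0\<^sub>m d 0)"
    unfolding append_cols_def using assms
    by (subst transpose_four_block_mat[of _ m b _ d _ 0]) auto
  have "four_block_mat (U * L) (0\<^sub>m n d) (0\<^sub>m 0 b) (0\<^sub>m 0 d) * four_block_mat V\<^sup>T (0\<^sub>m b 0) Vb\<^sup>T (0\<^sub>m d 0)
      = four_block_mat (U * L * V\<^sup>T) (0\<^sub>m n 0) (0\<^sub>m 0 m) (0\<^sub>m 0 0)"
    using assms by (subst mult_four_block_mat[of _ n b _ d _ 0 _ _ m _ 0]) auto
  also have "\<dots> = U * L * V\<^sup>T" using assms by (intro eq_matI) auto
  finally show ?thesis unfolding UL V .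
qed

lemma col_append_cols:
  assumes "U \<in> carrier_mat n a" "Ub \<in> carrier_mat n c"
  shows "i < a \<Longrightarrow> col (U @\<^sub>c Ub) i = col U i" "j < c \<Longrightarrow> col (U @\<^sub>c Ub) (j + a) = col Ub j"
  using assms by (auto simp: append_cols_def intro!: eq_vecI)

lemma index_two_sided_product:
  fixes Q :: "real mat"
  assumes "U \<in> carrier_mat n a" "V \<in> carrier_mat n b" "Q \<in> carrier_mat n n" "i < a" "j < b"
  shows "(U\<^sup>T * Q * V) $$ (i, j) = col U i \<bullet> (Q *\<^sub>v col V j)"
proof -
  have "U\<^sup>T * Q * V = U\<^sup>T * (Q * V)" using assms by (simp add: assoc_mult_mat[of _ a n _ n _ b])
  then show ?thesis using assms by (simp add: col_mult2[of _ n n _ b] mult_mat_vec_def)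
qed

text \<open>
  In the coordinates given by the completed bases, the diagonal blocks of \<open>Q\<close> are the compressions
  that occur in the optimality condition.
\<close>

lemma split_block_append_cols:
  fixes Q :: "real mat"
  assumes U: "U \<in> carrier_mat n r" "Ub \<in> carrier_mat n (n - r)" "real_unitary_mat n (U @\<^sub>c Ub)"
    and V: "V \<in> carrier_mat n r" "Vb \<in> carrier_mat n (n - r)" "real_unitary_mat n (V @\<^sub>c Vb)"
    and r: "r \<le> n" and Q: "Q \<in> carrier_mat n n" and R: "R \<in> carrier_mat n n"
    and eq: "Q = (U @\<^sub>c Ub) * R * (V @\<^sub>c Vb)\<^sup>T"
    and blocks: "split_block R r r = (A, B, C, D)"
  shows "A = U\<^sup>T * Q * V" "D = Ub\<^sup>T * Q * Vb"
proof -
  have c: "U @\<^sub>c Ub \<in> carrier_mat n n" "V @\<^sub>c Vb \<in> carrier_mat n n"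
    using U(3) V(3) by (auto simp: real_unitary_mat_def)
  have R_eq: "R = (U @\<^sub>c Ub)\<^sup>T * Q * (V @\<^sub>c Vb)"
    using real_unitary_mat_cancel[OF U(3) V(3) R] eq by simp
  have Rij: "R $$ (i, j) = col (U @\<^sub>c Ub) i \<bullet> (Q *\<^sub>v col (V @\<^sub>c Vb) j)" if "i < n" "j < n" for i j
    unfolding R_eq by (rule index_two_sided_product[OF c Q that])
  have AD: "A = mat r r (\<lambda>(i, j). R $$ (i, j))" "D = mat (n - r) (n - r) (\<lambda>(i, j). R $$ (i + r, j + r))"
    using blocks R by (auto simp: split_block_def Let_def)
  show "A = U\<^sup>T * Q * V"
  proof (rule eq_matI)
    fix i j assume "i < dim_row (U\<^sup>T * Q * V)" "j < dim_col (U\<^sup>T * Q * V)"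
    then have ij: "i < r" "j < r" using U V by auto
    have "A $$ (i, j) = R $$ (i, j)" using ij by (simp add: AD)
    also have "\<dots> = col U i \<bullet> (Q *\<^sub>v col V j)"
      using ij r by (simp add: Rij col_append_cols[OF U(1,2)] col_append_cols[OF V(1,2)])
    finally show "A $$ (i, j) = (U\<^sup>T * Q * V) $$ (i, j)"
      unfolding index_two_sided_product[OF U(1) V(1) Q ij] .
  qed (use U V in \<open>auto simp: AD\<close>)
  show "D = Ub\<^sup>T * Q * Vb"
  proof (rule eq_matI)
    fix i j assume "i < dim_row (Ub\<^sup>T * Q * Vb)" "j < dim_col (Ub\<^sup>T * Q * Vb)"
    then have ij: "i < n - r" "j < n - r" using U V by auto
    have "D $$ (i, j) = R $$ (i + r, j + r)" using ij by (simp add: AD)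
    also have "\<dots> = col Ub i \<bullet> (Q *\<^sub>v col Vb j)"
      using ij r by (simp add: Rij col_append_cols[OF U(1,2)] col_append_cols[OF V(1,2)])
    finally show "D $$ (i, j) = (Ub\<^sup>T * Q * Vb) $$ (i, j)"
      unfolding index_two_sided_product[OF U(2) V(2) Q ij] .
  qed (use U V in \<open>auto simp: AD\<close>)
qed

lemma compact_svdD:
  assumes "compact_svd M U L V" "M \<in> carrier_mat n n"
  defines "k \<equiv> vec_space.rank n M"
  shows "U \<in> carrier_mat n k" "V \<in> carrier_mat n k" "L \<in> carrier_mat k k"
    "diagonal_mat L" "\<And>i. i < k \<Longrightarrow> L $$ (i, i) > 0" "M = U * L * V\<^sup>T"
proof -
  have dims: "dim_row M = n" "dim_col M = n" using assms(2) by auto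
  show L: "U \<in> carrier_mat n k" "V \<in> carrier_mat n k" "L \<in> carrier_mat k k"
    "diagonal_mat L" "M = U * L * V\<^sup>T"
    using assms(1) unfolding compact_svd_def Let_def dims k_def by blast+
  have diag: "mset (diag_mat L) = filter_mset (\<lambda>s. s > 0) (singular_values M)"
    using assms(1) unfolding compact_svd_def Let_def by blast
  fix i assume "i < k"
  then have "L $$ (i, i) \<in># mset (diag_mat L)" using L(3) by (auto simp: diag_mat_def)
  then show "L $$ (i, i) > 0" unfolding diag by simp
qed

lemma corner_eq_mat_diag:
  fixes L :: "real mat"
  assumes "L \<in> carrier_mat k k" "diagonal_mat L"
  shows "four_block_mat L (0\<^sub>m k c) (0\<^sub>m c k) (0\<^sub>m c c) = mat_diag (k + c) (\<lambda>i. if i < k then L $$ (i, i) else 0)"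
  using assms by (intro eq_matI) (auto simp: mat_diag_def diagonal_mat_def)

text \<open>
  The row space of a diagonal matrix consists of the vectors supported where the diagonal is
  nonzero. This translates the inclusions of row and column spaces into statements on entries.
\<close>

lemma row_space_subset_diagonal_iff:
  fixes B :: "real mat"
  assumes B: "B \<in> carrier_mat k m"
  shows "vec_space.row_space m B \<subseteq> vec_space.row_space m (mat_diag m d)
    \<longleftrightarrow> (\<forall>i<k. \<forall>j<m. d j = 0 \<longrightarrow> B $$ (i, j) = 0)"
proof -
  interpret vec_space "TYPE(real)" m .
  have D: "mat_diag m d \<in> carrier_mat m m" by simp
  have Dt: "(mat_diag m d)\<^sup>T = mat_diag m d" by (rule eq_matI) (auto simp: mat_diag_def)
  have Dz: "(mat_diag m d *\<^sub>v z) $ j = d j * z $ j" if "z \<in> carrier_vec m" "j < m" for z j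
  proof -
    have "(mat_diag m d *\<^sub>v z) $ j = (\<Sum>k<m. (if j = k then d k else 0) * z $ k)"
      using that by (auto simp: scalar_prod_def mat_diag_def lessThan_atLeast0 intro!: sum.cong)
    also have "\<dots> = (\<Sum>k<m. if j = k then d k * z $ k else 0)" by (intro sum.cong) auto
    finally show ?thesis using that by simp
  qed
  have rowB: "row_space B = {w \<in> carrier_vec m. \<exists>y\<in>carrier_vec k. B\<^sup>T *\<^sub>v y = w}"
    using row_space_eq[OF B] B by simp
  have rowD: "row_space (mat_diag m d) = {w \<in> carrier_vec m. \<exists>y\<in>carrier_vec m. mat_diag m d *\<^sub>v y = w}"
    using row_space_eq[OF D] Dt D by simp
  have ByT: "(B\<^sup>T *\<^sub>v y) $ j = (\<Sum>i<k. B $$ (i, j) * y $ i)" if "y \<in> carrier_vec k" "j < m" for y j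
    using that B by (auto simp: scalar_prod_def lessThan_atLeast0 intro!: sum.cong)
  show ?thesis
  proof (intro iffI allI impI)
    fix i j assume sub: "row_space B \<subseteq> row_space (mat_diag m d)" and ij: "i < k" "j < m" and dj: "d j = 0"
    have "B\<^sup>T *\<^sub>v unit_vec k i \<in> row_space B" unfolding rowB using B by auto
    then obtain y where y: "y \<in> carrier_vec m" "mat_diag m d *\<^sub>v y = B\<^sup>T *\<^sub>v unit_vec k i"
      using sub unfolding rowD by auto
    have "B $$ (i, j) = (\<Sum>l<k. if i = l then B $$ (l, j) else 0)" using ij by simp
    also have "\<dots> = (\<Sum>l<k. B $$ (l, j) * unit_vec k i $ l)" using ij(1) by (intro sum.cong) auto
    also have "\<dots> = (B\<^sup>T *\<^sub>v unit_vec k i) $ j" using ByT[of "unit_vec k i" j] ij by simp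
    also have "\<dots> = 0" using Dz[OF y(1) ij(2)] y(2) dj by simp
    finally show "B $$ (i, j) = 0" .
  next
    assume zero: "\<forall>i<k. \<forall>j<m. d j = 0 \<longrightarrow> B $$ (i, j) = 0"
    show "row_space B \<subseteq> row_space (mat_diag m d)"
    proof
      fix w assume "w \<in> row_space B"
      then obtain y where w: "w \<in> carrier_vec m" and y: "y \<in> carrier_vec k" "B\<^sup>T *\<^sub>v y = w"
        unfolding rowB by auto
      have w0: "w $ j = 0" if "j < m" "d j = 0" for j
        using ByT[OF y(1) that(1)] y(2) zero that by simp
      have "mat_diag m d *\<^sub>v vec m (\<lambda>j. w $ j / d j) = w"
      proof (rule eq_vecI)
        fix j assume "j < dim_vec w"
        then have j: "j < m" using w by simp
        have "(mat_diag m d *\<^sub>v vec m (\<lambda>j. w $ j / d j)) $ j = d j * (w $ j / d j)"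
          using Dz[of "vec m (\<lambda>j. w $ j / d j)" j] j by simp
        then show "(mat_diag m d *\<^sub>v vec m (\<lambda>j. w $ j / d j)) $ j = w $ j"
          using w0[OF j] by (cases "d j = 0") auto
      qed (use w in \<open>auto simp: mat_diag_def\<close>)
      then show "w \<in> row_space (mat_diag m d)" unfolding rowD using w by (auto intro!: bexI[of _ "vec m (\<lambda>j. w $ j / d j)"])
    qed
  qed
qed

lemma col_space_subset_diagonal_iff:
  fixes C :: "real mat"
  assumes C: "C \<in> carrier_mat m k"
  shows "vec_space.col_space m C \<subseteq> vec_space.col_space m (mat_diag m d)
    \<longleftrightarrow> (\<forall>i<m. \<forall>j<k. d i = 0 \<longrightarrow> C $$ (i, j) = 0)"
proof -
  have Dt: "(mat_diag m d)\<^sup>T = mat_diag m d" by (rule eq_matI) (auto simp: mat_diag_def)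
  have "vec_space.row_space m C\<^sup>T \<subseteq> vec_space.row_space m (mat_diag m d)
      \<longleftrightarrow> (\<forall>j<k. \<forall>i<m. d i = 0 \<longrightarrow> C\<^sup>T $$ (j, i) = 0)"
    by (rule row_space_subset_diagonal_iff) (use C in auto)
  then show ?thesis using C Dt by (auto simp: vec_space.col_space_eq_row_space_transpose)
qed

section \<open>Unique nuclear norm minimizers\<close>

text \<open>
  One direction \<open>Q\<close> at the point \<open>X\<close>, together with the two changes of coordinates that lead from
  \<open>Q\<close> to \<open>Q'\<close> and from \<open>Q'\<close> to \<open>Q''\<close>.
\<close>

locale svd_direction =
  fixes n r :: nat
    and X UX LX VX UXbar VXbar :: "real mat"
    and Q Q' A' B' C' D' UD LD VD UDbar VDbar Q'' A'' B'' C'' D'' :: "real mat"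
  assumes X: "X \<in> carrier_mat n n" and rank_X: "vec_space.rank n X = r"
    and svd_X: "compact_svd X UX LX VX"
    and UXbar: "UXbar \<in> carrier_mat n (n - r)" "real_unitary_mat n (UX @\<^sub>c UXbar)"
    and VXbar: "VXbar \<in> carrier_mat n (n - r)" "real_unitary_mat n (VX @\<^sub>c VXbar)"
    and Q: "Q \<in> carrier_mat n n"
    and Q'_carrier: "Q' \<in> carrier_mat n n"
    and Q'_eq: "Q = (UX @\<^sub>c UXbar) * Q' * (VX @\<^sub>c VXbar)\<^sup>T"
    and Q'_blocks: "split_block Q' r r = (A', B', C', D')"
    and svd_D': "compact_svd D' UD LD VD"
    and UDbar: "UDbar \<in> carrier_mat (n - r) (n - r - vec_space.rank (n - r) D')"
      "real_unitary_mat (n - r) (UD @\<^sub>c UDbar)"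
    and VDbar: "VDbar \<in> carrier_mat (n - r) (n - r - vec_space.rank (n - r) D')"
      "real_unitary_mat (n - r) (VD @\<^sub>c VDbar)"
    and Q''_carrier: "Q'' \<in> carrier_mat n n"
    and Q''_eq: "Q' =
        four_block_mat (1\<^sub>m r) (0\<^sub>m r (n - r)) (0\<^sub>m (n - r) r) (UD @\<^sub>c UDbar)
        * Q''
        * (four_block_mat (1\<^sub>m r) (0\<^sub>m r (n - r)) (0\<^sub>m (n - r) r) (VD @\<^sub>c VDbar))\<^sup>T"
    and Q''_blocks: "split_block Q'' r r = (A'', B'', C'', D'')"
begin

text \<open>
  The two changes of coordinates compose to a single pair of orthogonal matrices. The second one
  acts as the identity on the first \<open>r\<close> coordinates, so it does not disturb the diagonal form of \<open>X\<close>;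
  it makes the lower right block of \<open>Q''\<close> diagonal and nonnegative, so that the nuclear norm of this
  block is its trace.
\<close>

lemma rotated_coordinates:
  obtains P R x d where "real_unitary_mat n P" "real_unitary_mat n R"
    "X = P * mat_diag n x * R\<^sup>T" "Q = P * Q'' * R\<^sup>T"
    "\<And>i. i < r \<Longrightarrow> x i > 0" "\<And>i. r \<le> i \<Longrightarrow> x i = 0"
    "D'' = mat_diag (n - r) d" "\<And>i. d i \<ge> 0" "r \<le> n"
    "trace_mat (UX\<^sup>T * Q * VX) + nuclear_norm (UXbar\<^sup>T * Q * VXbar) = trace_mat Q''"
proof -
  let ?PU = "UX @\<^sub>c UXbar" and ?PV = "VX @\<^sub>c VXbar"
  let ?PD = "UD @\<^sub>c UDbar" and ?PE = "VD @\<^sub>c VDbar"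
  let ?blk = "\<lambda>W. four_block_mat (1\<^sub>m r) (0\<^sub>m r (n - r)) (0\<^sub>m (n - r) r) W"
  have svdX: "UX \<in> carrier_mat n r" "VX \<in> carrier_mat n r" "LX \<in> carrier_mat r r"
    "diagonal_mat LX" "\<And>i. i < r \<Longrightarrow> LX $$ (i, i) > 0" "X = UX * LX * VX\<^sup>T"
    using compact_svdD[OF svd_X X] unfolding rank_X by auto
  have cU: "?PU \<in> carrier_mat n n" and cV: "?PV \<in> carrier_mat n n"
    using UXbar VXbar by (auto simp: real_unitary_mat_def)
  have "dim_col ?PU = r + (n - r)" using svdX UXbar(1) by (simp add: append_cols_def)
  then have rn: "r \<le> n" using cU by simp
  define x where "x i = (if i < r then LX $$ (i, i) else 0)" for i
  have x_block: "mat_diag n x = four_block_mat LX (0\<^sub>m r (n - r)) (0\<^sub>m (n - r) r) (0\<^sub>m (n - r) (n - r))"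
    using corner_eq_mat_diag[OF svdX(3,4), of "n - r"] rn by (simp add: x_def[abs_def])
  have X_eq: "X = ?PU * mat_diag n x * ?PV\<^sup>T"
    unfolding x_block append_cols_mult_corner[OF svdX(1) UXbar(1) svdX(2) VXbar(1) svdX(3)]
    by (rule svdX(6))

  have blk_Q': "A' = UX\<^sup>T * Q * VX" "D' = UXbar\<^sup>T * Q * VXbar"
    using split_block_append_cols[OF svdX(1) UXbar svdX(2) VXbar rn Q Q'_carrier Q'_eq Q'_blocks] by auto
  have rr: "r + (n - r) = n" using rn by simp
  have dQ': "dim_row Q' = r + (n - r)" "dim_col Q' = r + (n - r)" using Q'_carrier rr by auto
  have dQ'': "dim_row Q'' = r + (n - r)" "dim_col Q'' = r + (n - r)" using Q''_carrier rr by auto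
  note s' = split_block[OF Q'_blocks dQ']
  note s'' = split_block[OF Q''_blocks dQ'']
  have cD: "?PD \<in> carrier_mat (n - r) (n - r)" and cE: "?PE \<in> carrier_mat (n - r) (n - r)"
    using UDbar VDbar by (auto simp: real_unitary_mat_def)
  have blkPD: "real_unitary_mat n (?blk ?PD)" and blkPE: "real_unitary_mat n (?blk ?PE)"
    using real_unitary_mat_one_block[OF UDbar(2), of r] real_unitary_mat_one_block[OF VDbar(2), of r] rr
    by auto
  have blkPE_t: "(?blk ?PE)\<^sup>T = ?blk ?PE\<^sup>T"
    using cE by (subst transpose_block_diagonal[of _ r r _ "n - r" "n - r"]) auto
  have Q'_prod: "Q' = four_block_mat A'' (B'' * ?PE\<^sup>T) (?PD * C'') (?PD * D'' * ?PE\<^sup>T)"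
  proof -
    have 1: "?blk ?PD * Q'' = four_block_mat A'' B'' (?PD * C'') (?PD * D'')"
      unfolding s''(5) using s'' cD
      by (subst mult_four_block_mat[of _ r r _ "n - r" _ "n - r" _ _ r _ "n - r"]) auto
    have "four_block_mat A'' B'' (?PD * C'') (?PD * D'') * ?blk ?PE\<^sup>T
        = four_block_mat A'' (B'' * ?PE\<^sup>T) (?PD * C'') (?PD * D'' * ?PE\<^sup>T)"
      using s'' cD cE
      by (subst mult_four_block_mat[of _ r r _ "n - r" _ "n - r" _ _ r _ "n - r"]) auto
    then show ?thesis unfolding Q''_eq blkPE_t 1 .
  qed
  have A'_eq: "A' = A''" and D'_eq: "D' = ?PD * D'' * ?PE\<^sup>T"
  proof -
    have entry: "Q' $$ (i, j) = four_block_mat A'' (B'' * ?PE\<^sup>T) (?PD * C'') (?PD * D'' * ?PE\<^sup>T) $$ (i, j)"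
      for i j using Q'_prod by simp
    have AD: "A' = mat r r (\<lambda>(i, j). Q' $$ (i, j))" "D' = mat (n - r) (n - r) (\<lambda>(i, j). Q' $$ (i + r, j + r))"
      using Q'_blocks dQ' by (auto simp: split_block_def Let_def)
    show "A' = A''" by (rule eq_matI) (use s'' cD cE in \<open>auto simp: AD entry\<close>)
    show "D' = ?PD * D'' * ?PE\<^sup>T" by (rule eq_matI) (use s'' cD cE in \<open>auto simp: AD entry simp del: assoc_mult_mat\<close>)
  qed

  define k where "k = vec_space.rank (n - r) D'"
  note svdD = compact_svdD[OF svd_D' s'(4), folded k_def]
  have "dim_col ?PD = k + (n - r - k)" using svdD(1) UDbar(1)[folded k_def] by (simp add: append_cols_def)
  then have kn: "k + (n - r - k) = n - r" using cD by simp
  define d where "d i = (if i < k then LD $$ (i, i) else 0)" for i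
  have d_block: "mat_diag (n - r) d
      = four_block_mat LD (0\<^sub>m k (n - r - k)) (0\<^sub>m (n - r - k) k) (0\<^sub>m (n - r - k) (n - r - k))"
    using corner_eq_mat_diag[OF svdD(3,4), of "n - r - k"] unfolding kn d_def[abs_def] by (rule sym)
  have D'_svd: "D' = ?PD * mat_diag (n - r) d * ?PE\<^sup>T"
    unfolding d_block
      append_cols_mult_corner[OF svdD(1) UDbar(1)[folded k_def] svdD(2) VDbar(1)[folded k_def] svdD(3)]
    by (rule svdD(6))
  have D''_eq: "D'' = mat_diag (n - r) d"
    using real_unitary_mat_cancel[OF UDbar(2) VDbar(2) s''(4)]
      real_unitary_mat_cancel[OF UDbar(2) VDbar(2) mat_diag_dim, of d] D'_eq D'_svd by simp
  have d: "d i \<ge> 0" for i using svdD(5)[of i] by (auto simp: d_def)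

  have trD: "trace_mat D'' = nuclear_norm D'"
  proof -
    have "trace_mat D'' = (\<Sum>i<n - r. d i)"
      unfolding D''_eq by (subst trace_mat_eq_sum[of _ "n - r"]) (auto simp: mat_diag_def)
    also have "\<dots> = nuclear_norm D'"
      unfolding D'_svd using nuclear_norm_of_svd[OF UDbar(2) VDbar(2), of d] d by simp
    finally show ?thesis .
  qed
  have "trace_mat Q'' = trace_mat A'' + trace_mat D''"
    unfolding s''(5) trace_mat_def diag_four_block_mat[OF s''(1,4)] by simp
  then have tr: "trace_mat (UX\<^sup>T * Q * VX) + nuclear_norm (UXbar\<^sup>T * Q * VXbar) = trace_mat Q''"
    using trD A'_eq blk_Q' by simp

  let ?P = "?PU * ?blk ?PD" and ?R = "?PV * ?blk ?PE"
  have c: "?blk ?PD \<in> carrier_mat n n" "?blk ?PE \<in> carrier_mat n n"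
    using blkPD blkPE by (auto simp: real_unitary_mat_def)
  have shift: "?P * M * ?R\<^sup>T = ?PU * (?blk ?PD * M * (?blk ?PE)\<^sup>T) * ?PV\<^sup>T" if "M \<in> carrier_mat n n" for M
    unfolding transpose_mult[OF cV c(2)] using cU cV c that
    by (simp add: square_mat_assoc[where n = n])
  have "?blk ?PD * mat_diag n x * (?blk ?PE)\<^sup>T = mat_diag n x"
  proof -
    have "?blk ?PD * mat_diag n x = mat_diag n x"
      unfolding x_block using svdX(3) cD by (subst mult_block_diagonal[of _ r r _ "n - r" "n - r" _ r _ "n - r"]) auto
    moreover have "mat_diag n x * ?blk ?PE\<^sup>T = mat_diag n x"
      unfolding x_block using svdX(3) cE by (subst mult_block_diagonal[of _ r r _ "n - r" "n - r" _ r _ "n - r"]) auto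
    ultimately show ?thesis unfolding blkPE_t by simp
  qed
  then have "X = ?P * mat_diag n x * ?R\<^sup>T" using shift[OF mat_diag_dim, of x] X_eq by simp
  moreover have "Q = ?P * Q'' * ?R\<^sup>T" using shift[OF Q''_carrier] Q'_eq Q''_eq by simp
  moreover have "real_unitary_mat n ?P" "real_unitary_mat n ?R"
    using real_unitary_mat_mult UXbar(2) VXbar(2) blkPD blkPE by auto
  moreover have "\<And>i. i < r \<Longrightarrow> x i > 0" "\<And>i. r \<le> i \<Longrightarrow> x i = 0" using svdX(5) by (auto simp: x_def)
  ultimately show ?thesis using that[of ?P ?R x d] D''_eq d rn tr by blast
qed

text \<open>
  The one-sided derivative of the nuclear norm at \<open>X\<close> in the direction \<open>Q\<close>.
\<close>

abbreviation slope :: real where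
  "slope \<equiv> trace_mat (UX\<^sup>T * Q * VX) + nuclear_norm (UXbar\<^sup>T * Q * VXbar)"

abbreviation rows_included :: bool where
  "rows_included \<equiv> vec_space.row_space (n - r) B'' \<subseteq> vec_space.row_space (n - r) D''"

abbreviation cols_included :: bool where
  "cols_included \<equiv> vec_space.col_space (n - r) C'' \<subseteq> vec_space.col_space (n - r) D''"

text \<open>
  Everything that the optimality condition says about \<open>Q\<close>, expressed by the entries of \<open>Q''\<close>.
\<close>

lemma diagonal_model:
  obtains x where "\<And>t. nuclear_norm (X + t \<cdot>\<^sub>m Q) = nuclear_norm (mat_diag n x + t \<cdot>\<^sub>m Q'')"
    "nuclear_norm X = nuclear_norm (mat_diag n x)"
    "\<And>i. i < r \<Longrightarrow> x i > 0" "\<And>i. r \<le> i \<Longrightarrow> x i = 0"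
    "\<And>i j. r \<le> i \<Longrightarrow> r \<le> j \<Longrightarrow> i < n \<Longrightarrow> j < n \<Longrightarrow> i \<noteq> j \<Longrightarrow> Q'' $$ (i, j) = 0"
    "\<And>i. r \<le> i \<Longrightarrow> i < n \<Longrightarrow> Q'' $$ (i, i) \<ge> 0"
    "rows_included \<longleftrightarrow> (\<forall>i j. i < r \<longrightarrow> r \<le> j \<longrightarrow> j < n \<longrightarrow> Q'' $$ (j, j) = 0 \<longrightarrow> Q'' $$ (i, j) = 0)"
    "cols_included \<longleftrightarrow> (\<forall>i j. i < r \<longrightarrow> r \<le> j \<longrightarrow> j < n \<longrightarrow> Q'' $$ (j, j) = 0 \<longrightarrow> Q'' $$ (j, i) = 0)"
    "slope = trace_mat Q''" "r \<le> n"
proof -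
  obtain P R x d where P: "real_unitary_mat n P" and R: "real_unitary_mat n R"
    and X_eq: "X = P * mat_diag n x * R\<^sup>T" and Q_eq: "Q = P * Q'' * R\<^sup>T"
    and x: "\<And>i. i < r \<Longrightarrow> x i > 0" "\<And>i. r \<le> i \<Longrightarrow> x i = 0"
    and D: "D'' = mat_diag (n - r) d" and d: "\<And>i. d i \<ge> 0" and rn: "r \<le> n"
    and slope: "slope = trace_mat Q''"
    by (rule rotated_coordinates) blast
  note Qc = Q''_carrier
  have PRc: "P \<in> carrier_mat n n" "R \<in> carrier_mat n n"
    using P R by (auto simp: real_unitary_mat_def)
  have dQ: "dim_row Q'' = r + (n - r)" "dim_col Q'' = r + (n - r)" using Qc rn by auto
  note blocks = split_block[OF Q''_blocks dQ]
  have blk: "B'' = mat r (n - r) (\<lambda>(i, j). Q'' $$ (i, j + r))"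
    "C'' = mat (n - r) r (\<lambda>(i, j). Q'' $$ (i + r, j))"
    "D'' = mat (n - r) (n - r) (\<lambda>(i, j). Q'' $$ (i + r, j + r))"
    using Q''_blocks Qc by (auto simp: split_block_def Let_def)
  have corner: "Q'' $$ (i, j) = (if i = j then d (i - r) else 0)"
    if "r \<le> i" "r \<le> j" "i < n" "j < n" for i j
  proof -
    have "Q'' $$ (i, j) = D'' $$ (i - r, j - r)" using that by (simp add: blk(3))
    then show ?thesis using that by (auto simp: D mat_diag_def)
  qed
  have shift: "(\<forall>j<n - r. p j) \<longleftrightarrow> (\<forall>j. r \<le> j \<longrightarrow> j < n \<longrightarrow> p (j - r))" for p
    by (metis add_diff_cancel_right' diff_less_mono le_add2 less_diff_conv)
  have B_entry: "B'' $$ (i, j - r) = Q'' $$ (i, j)" if "i < r" "r \<le> j" "j < n" for i j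
    using that by (simp add: blk(1))
  have C_entry: "C'' $$ (j - r, i) = Q'' $$ (j, i)" if "i < r" "r \<le> j" "j < n" for i j
    using that by (simp add: blk(2))
  have "rows_included \<longleftrightarrow> (\<forall>i<r. \<forall>j. r \<le> j \<longrightarrow> j < n \<longrightarrow> d (j - r) = 0 \<longrightarrow> B'' $$ (i, j - r) = 0)"
    unfolding D row_space_subset_diagonal_iff[OF blocks(2)] shift ..
  also have "\<dots> \<longleftrightarrow> (\<forall>i j. i < r \<longrightarrow> r \<le> j \<longrightarrow> j < n \<longrightarrow> Q'' $$ (j, j) = 0 \<longrightarrow> Q'' $$ (i, j) = 0)"
    using corner B_entry by metis
  finally have rows: "rows_included \<longleftrightarrow>
    (\<forall>i j. i < r \<longrightarrow> r \<le> j \<longrightarrow> j < n \<longrightarrow> Q'' $$ (j, j) = 0 \<longrightarrow> Q'' $$ (i, j) = 0)" .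
  have "cols_included \<longleftrightarrow> (\<forall>j. r \<le> j \<longrightarrow> j < n \<longrightarrow> (\<forall>i<r. d (j - r) = 0 \<longrightarrow> C'' $$ (j - r, i) = 0))"
    unfolding D col_space_subset_diagonal_iff[OF blocks(3)] shift ..
  also have "\<dots> \<longleftrightarrow> (\<forall>i j. i < r \<longrightarrow> r \<le> j \<longrightarrow> j < n \<longrightarrow> Q'' $$ (j, j) = 0 \<longrightarrow> Q'' $$ (j, i) = 0)"
    using corner C_entry by metis
  finally have cols: "cols_included \<longleftrightarrow>
    (\<forall>i j. i < r \<longrightarrow> r \<le> j \<longrightarrow> j < n \<longrightarrow> Q'' $$ (j, j) = 0 \<longrightarrow> Q'' $$ (j, i) = 0)" .
  have nn: "nuclear_norm (X + t \<cdot>\<^sub>m Q) = nuclear_norm (mat_diag n x + t \<cdot>\<^sub>m Q'')" for t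
  proof -
    have tQ: "t \<cdot>\<^sub>m Q'' \<in> carrier_mat n n" and PQ: "P * Q'' \<in> carrier_mat n n" using Qc PRc by auto
    have Px: "P * mat_diag n x \<in> carrier_mat n n" by (rule mult_carrier_mat[OF PRc(1) mat_diag_dim])
    have "P * (mat_diag n x + t \<cdot>\<^sub>m Q'') = P * mat_diag n x + t \<cdot>\<^sub>m (P * Q'')"
      using mult_add_distrib_mat[OF PRc(1) mat_diag_dim tQ] mult_smult_distrib[OF PRc(1) Qc] by simp
    moreover have "(P * mat_diag n x + t \<cdot>\<^sub>m (P * Q'')) * R\<^sup>T = X + t \<cdot>\<^sub>m Q"
      unfolding X_eq Q_eq
      by (subst add_mult_distrib_mat[OF Px]) (use PQ PRc in \<open>auto simp: mult_smult_assoc_mat[OF PQ]\<close>)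
    ultimately show ?thesis
      using nuclear_norm_unitary_invariant[OF P R, of "mat_diag n x + t \<cdot>\<^sub>m Q''"] Qc by simp
  qed
  have nnX: "nuclear_norm X = nuclear_norm (mat_diag n x)"
    unfolding X_eq by (rule nuclear_norm_unitary_invariant[OF P R]) simp
  show ?thesis
    by (rule that[OF nn nnX x _ _ rows cols slope rn]) (use corner d in auto)
qed

lemma negative_slope_imp_descent:
  assumes "slope < 0"
  obtains t where "t > 0" "nuclear_norm (X + t \<cdot>\<^sub>m Q) < nuclear_norm X"
proof -
  obtain x where nn: "\<And>t. nuclear_norm (X + t \<cdot>\<^sub>m Q) = nuclear_norm (mat_diag n x + t \<cdot>\<^sub>m Q'')"
    and nnX: "nuclear_norm X = nuclear_norm (mat_diag n x)"
    and x: "\<And>i. i < r \<Longrightarrow> x i > 0" "\<And>i. r \<le> i \<Longrightarrow> x i = 0"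
    and off: "\<And>i j. r \<le> i \<Longrightarrow> r \<le> j \<Longrightarrow> i < n \<Longrightarrow> j < n \<Longrightarrow> i \<noteq> j \<Longrightarrow> Q'' $$ (i, j) = 0"
    and diag: "\<And>i. r \<le> i \<Longrightarrow> i < n \<Longrightarrow> Q'' $$ (i, i) \<ge> 0" and slope: "slope = trace_mat Q''"
    by (rule diagonal_model) blast
  have tr: "trace_mat Q'' < 0" using assms slope by simp
  obtain t where "t > 0" "nuclear_norm (mat_diag n x + t \<cdot>\<^sub>m Q'') < nuclear_norm (mat_diag n x)"
    by (rule nuclear_norm_descent[OF Q''_carrier tr x off diag])
  then show ?thesis using that nn nnX by simp
qed

text \<open>
  In rotated coordinates, \<open>X + t Q\<close> is positive semidefinite for small \<open>t > 0\<close>, so its nuclear norm is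
  its trace, which does not depend on \<open>t\<close> when the slope is 0. By the symmetry of \<open>Q''\<close>, the inclusion
  of row spaces also controls the lower left block.
\<close>

lemma flat_direction_imp_other_minimizer:
  assumes "slope = 0" rows_included "symmetric_mat Q''"
  obtains t where "t > 0" "nuclear_norm (X + t \<cdot>\<^sub>m Q) = nuclear_norm X"
proof -
  obtain x where nn: "\<And>t. nuclear_norm (X + t \<cdot>\<^sub>m Q) = nuclear_norm (mat_diag n x + t \<cdot>\<^sub>m Q'')"
    and nnX: "nuclear_norm X = nuclear_norm (mat_diag n x)"
    and x: "\<And>i. i < r \<Longrightarrow> x i > 0" "\<And>i. r \<le> i \<Longrightarrow> x i = 0"
    and off: "\<And>i j. r \<le> i \<Longrightarrow> r \<le> j \<Longrightarrow> i < n \<Longrightarrow> j < n \<Longrightarrow> i \<noteq> j \<Longrightarrow> Q'' $$ (i, j) = 0"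
    and diag: "\<And>i. r \<le> i \<Longrightarrow> i < n \<Longrightarrow> Q'' $$ (i, i) \<ge> 0"
    and rows: "rows_included \<longleftrightarrow> (\<forall>i j. i < r \<longrightarrow> r \<le> j \<longrightarrow> j < n \<longrightarrow> Q'' $$ (j, j) = 0 \<longrightarrow> Q'' $$ (i, j) = 0)"
    and slope: "slope = trace_mat Q''"
    by (rule diagonal_model) blast
  have sym: "Q''\<^sup>T = Q''" using assms(3) by (simp add: symmetric_mat_def)
  have supp: "Q'' $$ (i, j) = 0" if "i < r" "i < n" "r \<le> j" "j < n" "Q'' $$ (j, j) = 0" for i j
    using assms(2) rows that by blast
  obtain t where t: "t > 0"
    "nuclear_norm (mat_diag n x + t \<cdot>\<^sub>m Q'') = trace_mat (mat_diag n x + t \<cdot>\<^sub>m Q'')"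
    by (rule nuclear_norm_eq_trace_near_diagonal[OF Q''_carrier sym x off diag supp])
  have x_nonneg: "x i \<ge> 0" for i using x[of i] by (cases "i < r") (auto intro: less_imp_le)
  have "trace_mat (mat_diag n x + t \<cdot>\<^sub>m Q'') = nuclear_norm (mat_diag n x)"
    using assms(1) slope x_nonneg by (simp add: trace_mat_diag_add_smult[OF Q''_carrier] nuclear_norm_mat_diag)
  then show ?thesis using that t nn nnX by simp
qed

text \<open>
  For nonnegative slope, a norm that does not increase forces the rotated \<open>X + Q\<close> to be positive
  semidefinite. Hence \<open>Q''\<close> is symmetric, and where its lower right block has a zero on the diagonal,
  its whole row and column vanish.
\<close>

lemma not_increased_imp_flat_direction:
  assumes "slope \<ge> 0" and le: "nuclear_norm (X + Q) \<le> nuclear_norm X"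
  shows "slope = 0" "rows_included" "cols_included" "symmetric_mat Q''"
proof -
  obtain x where nn: "\<And>t. nuclear_norm (X + t \<cdot>\<^sub>m Q) = nuclear_norm (mat_diag n x + t \<cdot>\<^sub>m Q'')"
    and nnX: "nuclear_norm X = nuclear_norm (mat_diag n x)"
    and x: "\<And>i. i < r \<Longrightarrow> x i > 0" "\<And>i. r \<le> i \<Longrightarrow> x i = 0"
    and rows: "rows_included \<longleftrightarrow> (\<forall>i j. i < r \<longrightarrow> r \<le> j \<longrightarrow> j < n \<longrightarrow> Q'' $$ (j, j) = 0 \<longrightarrow> Q'' $$ (i, j) = 0)"
    and cols: "cols_included \<longleftrightarrow> (\<forall>i j. i < r \<longrightarrow> r \<le> j \<longrightarrow> j < n \<longrightarrow> Q'' $$ (j, j) = 0 \<longrightarrow> Q'' $$ (j, i) = 0)"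
    and slope: "slope = trace_mat Q''" and rn: "r \<le> n"
    by (rule diagonal_model) blast
  have one: "1 \<cdot>\<^sub>m Q = Q" "1 \<cdot>\<^sub>m Q'' = Q''" by (auto intro!: eq_matI)
  have tr: "trace_mat Q'' \<ge> 0" using assms(1) slope by simp
  have x_nonneg: "x i \<ge> 0" for i using x[of i] by (cases "i < r") (auto intro: less_imp_le)
  have le': "nuclear_norm (mat_diag n x + Q'') \<le> nuclear_norm (mat_diag n x)"
    using le nn[of 1] nnX one by simp
  note psd = nuclear_norm_not_increased_imp_psd[OF x_nonneg Q''_carrier tr le']
  show "slope = 0" using slope psd(1) by simp
  show "symmetric_mat Q''" using psd(2) by (simp add: symmetric_mat_def)
  have zero: "Q'' $$ (i, j) = 0" if "i < r" "r \<le> j" "j < n" "Q'' $$ (j, j) = 0" for i j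
    using psd(3)[of i j] that x(2)[of j] by simp
  then show rows_included using rows by blast
  have "Q'' $$ (j, i) = Q'' $$ (i, j)" if "i < r" "j < n" for i j
    using arg_cong[OF psd(2), of "\<lambda>A. A $$ (i, j)"] Q''_carrier that rn by simp
  then show cols_included using zero cols by simp
qed

end

theorem theorem3p1:
  fixes n m r :: nat
    and \<A> :: "real mat \<Rightarrow> real vec" and b :: "real vec"
    and X UX LX VX UXbar VXbar :: "real mat"
    and Q' A' B' C' D' UD LD VD UDbar VDbar Q'' A'' B'' C'' D'' :: "real mat \<Rightarrow> real mat"
  assumes lin: "linear_map class_ring (module_mat TYPE(real) n n) (module_vec TYPE(real) m) \<A>"
    and X: "X \<in> carrier_mat n n"
    and rank_X: "vec_space.rank n X = r"
    and svd_X: "compact_svd X UX LX VX"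
    and b: "b = \<A> X"
    and UXbar: "UXbar \<in> carrier_mat n (n - r)" "real_unitary_mat n (UX @\<^sub>c UXbar)"
    and VXbar: "VXbar \<in> carrier_mat n (n - r)" "real_unitary_mat n (VX @\<^sub>c VXbar)"
    and Q'_carrier: "\<And>Q. Q \<in> carrier_mat n n \<Longrightarrow> Q' Q \<in> carrier_mat n n"
    and Q'_eq: "\<And>Q. Q \<in> carrier_mat n n \<Longrightarrow>
      Q = (UX @\<^sub>c UXbar) * Q' Q * (VX @\<^sub>c VXbar)\<^sup>T"
    and Q'_blocks: "\<And>Q. Q \<in> carrier_mat n n \<Longrightarrow>
      split_block (Q' Q) r r = (A' Q, B' Q, C' Q, D' Q)"
    and svd_D': "\<And>Q. Q \<in> carrier_mat n n \<Longrightarrow> compact_svd (D' Q) (UD Q) (LD Q) (VD Q)"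
    and UDbar: "\<And>Q. Q \<in> carrier_mat n n \<Longrightarrow>
        UDbar Q \<in> carrier_mat (n - r) (n - r - vec_space.rank (n - r) (D' Q))"
      "\<And>Q. Q \<in> carrier_mat n n \<Longrightarrow> real_unitary_mat (n - r) (UD Q @\<^sub>c UDbar Q)"
    and VDbar: "\<And>Q. Q \<in> carrier_mat n n \<Longrightarrow>
        VDbar Q \<in> carrier_mat (n - r) (n - r - vec_space.rank (n - r) (D' Q))"
      "\<And>Q. Q \<in> carrier_mat n n \<Longrightarrow> real_unitary_mat (n - r) (VD Q @\<^sub>c VDbar Q)"
    and Q''_carrier: "\<And>Q. Q \<in> carrier_mat n n \<Longrightarrow> Q'' Q \<in> carrier_mat n n"
    and Q''_eq: "\<And>Q. Q \<in> carrier_mat n n \<Longrightarrow>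
      Q' Q =
        four_block_mat (1\<^sub>m r) (0\<^sub>m r (n - r)) (0\<^sub>m (n - r) r) (UD Q @\<^sub>c UDbar Q)
        * Q'' Q
        * (four_block_mat (1\<^sub>m r) (0\<^sub>m r (n - r)) (0\<^sub>m (n - r) r) (VD Q @\<^sub>c VDbar Q))\<^sup>T"
    and Q''_blocks: "\<And>Q. Q \<in> carrier_mat n n \<Longrightarrow>
      split_block (Q'' Q) r r = (A'' Q, B'' Q, C'' Q, D'' Q)"
  shows "{Y. nuclear_norm_solution n \<A> b Y} = {X} \<longleftrightarrow>
    (\<forall>Q \<in> carrier_mat n n. Q \<noteq> 0\<^sub>m n n \<and> \<A> Q = 0\<^sub>v m \<longrightarrow>
      (trace_mat (UX\<^sup>T * Q * VX) + nuclear_norm (UXbar\<^sup>T * Q * VXbar) = 0 \<and>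
        (\<not> vec_space.row_space (n - r) (B'' Q) \<subseteq> vec_space.row_space (n - r) (D'' Q) \<or>
         \<not> vec_space.col_space (n - r) (C'' Q) \<subseteq> vec_space.col_space (n - r) (D'' Q) \<or>
         \<not> symmetric_mat (Q'' Q))) \<or>
      trace_mat (UX\<^sup>T * Q * VX) + nuclear_norm (UXbar\<^sup>T * Q * VXbar) > 0)"
proof -
  interpret lm: linear_map class_ring "module_mat TYPE(real) n n" "module_vec TYPE(real) m" \<A>
    by (rule lin)
  have \<A>_add: "\<A> (M + N) = \<A> M + \<A> N" if "M \<in> carrier_mat n n" "N \<in> carrier_mat n n" for M N
    using lm.f_add[of M N] that by (simp add: module_mat_simps module_vec_simps)
  have \<A>_smult: "\<A> (t \<cdot>\<^sub>m M) = t \<cdot>\<^sub>v \<A> M" if "M \<in> carrier_mat n n" for t M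
    using lm.f_smult[of t M] that by (simp add: module_mat_simps module_vec_simps class_ring_simps)
  have \<A>_carrier: "\<A> M \<in> carrier_vec m" if "M \<in> carrier_mat n n" for M
    using lm.f_im[of M] that by (simp add: module_mat_simps module_vec_simps)
  let ?value = "\<lambda>Q. trace_mat (UX\<^sup>T * Q * VX) + nuclear_norm (UXbar\<^sup>T * Q * VXbar)"
  let ?rows = "\<lambda>Q. vec_space.row_space (n - r) (B'' Q) \<subseteq> vec_space.row_space (n - r) (D'' Q)"
  let ?cols = "\<lambda>Q. vec_space.col_space (n - r) (C'' Q) \<subseteq> vec_space.col_space (n - r) (D'' Q)"
  \<comment> \<open>The directions along which the nuclear norm stays constant for a while.\<close>
  let ?flat = "\<lambda>Q. ?value Q = 0 \<and> ?rows Q \<and> ?cols Q \<and> symmetric_mat (Q'' Q)"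
  have dir: "svd_direction n r X UX LX VX UXbar VXbar Q (Q' Q) (A' Q) (B' Q) (C' Q) (D' Q)
      (UD Q) (LD Q) (VD Q) (UDbar Q) (VDbar Q) (Q'' Q) (A'' Q) (B'' Q) (C'' Q) (D'' Q)"
    if "Q \<in> carrier_mat n n" for Q
    unfolding svd_direction_def
    by (intro conjI X rank_X svd_X UXbar VXbar Q'_carrier Q'_eq Q'_blocks svd_D' UDbar VDbar
        Q''_carrier Q''_eq Q''_blocks that)
  note descent = svd_direction.negative_slope_imp_descent[OF dir]
    and other_minimizer = svd_direction.flat_direction_imp_other_minimizer[OF dir]
    and flat = svd_direction.not_increased_imp_flat_direction[OF dir]
  have feasible: "\<A> (X + t \<cdot>\<^sub>m Q) = b" if "Q \<in> carrier_mat n n" "\<A> Q = 0\<^sub>v m" for t Q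
  proof -
    have "t \<cdot>\<^sub>v 0\<^sub>v m = 0\<^sub>v m" by (rule eq_vecI) auto
    then show ?thesis using that X b \<A>_carrier[OF X] by (simp add: \<A>_add \<A>_smult)
  qed
  have "{Y. nuclear_norm_solution n \<A> b Y} = {X} \<longleftrightarrow>
    (\<forall>Q \<in> carrier_mat n n. Q \<noteq> 0\<^sub>m n n \<and> \<A> Q = 0\<^sub>v m \<longrightarrow> \<not> ?flat Q \<and> ?value Q \<ge> 0)"
  proof (intro iffI ballI impI)
    fix Q assume sol: "{Y. nuclear_norm_solution n \<A> b Y} = {X}"
      and Q: "Q \<in> carrier_mat n n" and null: "Q \<noteq> 0\<^sub>m n n \<and> \<A> Q = 0\<^sub>v m"
    have X_min: "nuclear_norm X \<le> nuclear_norm Z" if "Z \<in> carrier_mat n n" "\<A> Z = b" for Z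
      using sol that unfolding nuclear_norm_solution_def is_arg_min_def
      by (metis (mono_tags, lifting) linorder_not_less mem_Collect_eq singletonI)
    have carrier: "X + t \<cdot>\<^sub>m Q \<in> carrier_mat n n" for t using X Q by simp
    have "?value Q \<ge> 0"
    proof (rule ccontr)
      assume "\<not> ?thesis"
      then have "?value Q < 0" by simp
      then obtain t where "nuclear_norm (X + t \<cdot>\<^sub>m Q) < nuclear_norm X" by (rule descent[OF Q])
      then show False using X_min[OF carrier feasible[OF Q]] null by (meson linorder_not_less)
    qed
    moreover have "\<not> ?flat Q"
    proof
      assume "?flat Q"
      then have "?value Q = 0" "?rows Q" "symmetric_mat (Q'' Q)" by auto
      then obtain t where t: "t > 0" "nuclear_norm (X + t \<cdot>\<^sub>m Q) = nuclear_norm X"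
        by (rule other_minimizer[OF Q])
      have "nuclear_norm_solution n \<A> b (X + t \<cdot>\<^sub>m Q)"
        unfolding nuclear_norm_solution_def is_arg_min_def
        using carrier feasible[OF Q] null t(2) X_min by (auto simp: not_less)
      then have eq: "X + t \<cdot>\<^sub>m Q = X" using sol by blast
      have "Q = 0\<^sub>m n n"
      proof (rule eq_matI)
        fix i j assume "i < dim_row (0\<^sub>m n n)" "j < dim_col (0\<^sub>m n n)"
        then have "i < n" "j < n" by auto
        then show "Q $$ (i, j) = 0\<^sub>m n n $$ (i, j)"
          using arg_cong[OF eq, of "\<lambda>A. A $$ (i, j)"] X Q t(1) by simp
      qed (use Q in auto)
      then show False using null by simp
    qed
    ultimately show "\<not> ?flat Q \<and> ?value Q \<ge> 0" by blast
  next
    assume cond: "\<forall>Q \<in> carrier_mat n n. Q \<noteq> 0\<^sub>m n n \<and> \<A> Q = 0\<^sub>v m \<longrightarrow> \<not> ?flat Q \<and> ?value Q \<ge> 0"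
    have less: "nuclear_norm X < nuclear_norm Y" if Y: "Y \<in> carrier_mat n n" "\<A> Y = b" "Y \<noteq> X" for Y
    proof (rule ccontr)
      assume not_less: "\<not> ?thesis"
      define Q where "Q = Y + (- 1) \<cdot>\<^sub>m X"
      have Q: "Q \<in> carrier_mat n n" using Y X by (simp add: Q_def)
      have XQ: "X + Q = Y" unfolding Q_def by (rule eq_matI) (use X Y in auto)
      have "\<A> Q = 0\<^sub>v m"
        unfolding Q_def using X Y b \<A>_carrier[OF X] by (simp add: \<A>_add \<A>_smult) (auto intro!: eq_vecI)
      moreover have "Q \<noteq> 0\<^sub>m n n" using XQ X Y(3) by auto
      ultimately have "\<not> ?flat Q" "?value Q \<ge> 0" using cond Q by auto
      moreover have "nuclear_norm (X + Q) \<le> nuclear_norm X" using not_less XQ by simp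
      ultimately show False using flat[OF Q] by blast
    qed
    show "{Y. nuclear_norm_solution n \<A> b Y} = {X}"
      unfolding nuclear_norm_solution_def is_arg_min_def using less X b
      by (auto dest: less)
  qed
  also have "\<dots> \<longleftrightarrow> (\<forall>Q \<in> carrier_mat n n. Q \<noteq> 0\<^sub>m n n \<and> \<A> Q = 0\<^sub>v m \<longrightarrow>
      (?value Q = 0 \<and> (\<not> ?rows Q \<or> \<not> ?cols Q \<or> \<not> symmetric_mat (Q'' Q))) \<or> ?value Q > 0)"
    by (intro ball_cong refl imp_cong) linarith
  finally show ?thesis .
qed

end
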